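(* Let $\nu>-1$ and $q\in(0,1)$. Let $h_{\nu}^{(3)}(z;q)=c_{\nu}(q)z^{1-\frac{\nu}{2}}J_{\nu}^{(3)}(\sqrt{z};q)$. Then the radius of convexity $r^{c}\left(h_{\nu}^{(3)}(z;q)\right)$ of the function $z\mapsto h_{\nu}^{(3)}(z;q)$ is the smallest positive root of the equation (in $r$) $$(2-\nu)^2 J_{\nu}^{(3)}(\sqrt{r};q)+(5-2\nu)\sqrt{r}\,\bigl(J_{\nu}^{(3)}\bigr)'(\sqrt{r};q)+r\,\bigl(J_{\nu}^{(3)}\bigr)''(\sqrt{r};q)=0,$$ where $(J_\nu^{(3)})'(\sqrt r;q)$ and $(J_\nu^{(3)})''(\sqrt r;q)$ denote the first and second derivatives of $x\mapsto J_\nu^{(3)}(x;q)$ evaluated at $x=\sqrt r$, and it satisfies the following inequalities: $$\frac{(1-q)(1-q^{\nu+1})}{4q}<r^c\left(h_{\nu}^{(3)}(z;q)\right)<\frac{2(q^{\nu+1}-1)(q^{\nu+2}-1)(q^2-1)}{qE_{\nu}(q)},$$ $$\sqrt{\frac{(1-q)^2(1+q)(1-q^{\nu+1})^2(q^{\nu+2}-1)}{2q^{2}E_{\nu}(q)}}<r^c\left(h_{\nu}^{(3)}(z;q)\right)<\frac{(1-q^{\nu+1})(1-q^{\nu+3})E_{\nu}(q)T(q)}{2q(1+q)\left(K_{\nu}(q)+L_{\nu}(q)\right)},$$ where $$E_{\nu}(q)=8q^{\nu+3}-q^{\nu+2}+q-8,$$ $$K_{\nu}(q)=5q+11q^{\nu+2}-21q^{\nu+3}-34q^{\nu+4}-21q^{\nu+5}+11q^{\nu+6},$$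 $$L_{\nu}(q)=q^{2\nu+5}+5q^{2\nu+6}+5q^{2\nu+7}+16q^{2\nu+8}+5q^2+q^3+16,$$ $$T(q)=(q-1)(q^3+2q^2+2q+1).$$
   Context: For $q\in(0,1)$ and $a\in\mathbb{R}$: $(a;q)_0=1$, $(a;q)_n=\prod_{k=1}^{n}(1-aq^{k-1})$, $(a;q)_\infty=\prod_{k\ge1}(1-aq^{k-1})$. The Hahn-Exton $q$-Bessel function is, for $\nu>-1$, $$J_{\nu}^{(3)}(z;q)=\frac{(q^{\nu+1};q)_{\infty}}{(q;q)_{\infty}}\sum_{n\geq0}\frac{(-1)^{n}z^{2n+\nu}}{(q;q)_{n}(q^{\nu+1};q)_{n}}q^{\frac{1}{2}n(n+1)}.$$ Put $c_{\nu}(q)=(q;q)_{\infty}/(q^{\nu+1};q)_{\infty}$. The normalized function $h_\nu^{(3)}$ is understood as the entire function $$h_{\nu}^{(3)}(z;q)=c_{\nu}(q)z^{1-\frac{\nu}{2}}J_{\nu}^{(3)}(\sqrt{z};q)=\sum_{n\geq0}\frac{(-1)^nq^{\frac{1}{2}n(n+1)}}{(q;q)_{n}(q^{\nu+1};q)_{n}}z^{n+1}.$$ With $\mathbb{D}_r=\{z\in\mathbb{C}:|z|<r\}$, the radius of convexity of an analytic function $f$ (with $f'(0)\neq0$) is $$r^{c}(f)=\sup\left\{r>0:\Re\left(1+\frac{zf''(z)}{f'(z)}\right)>0\text{ for all }z\in\mathbb{D}_r\right\}.$$ *)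

theory Defs
  imports "HOL-Analysis.Analysis"
begin

definition qpoch :: "real \<Rightarrow> real \<Rightarrow> nat \<Rightarrow> real" where
  "qpoch a q n = (\<Prod>k=1..n. 1 - a * q ^ (k - 1))"

definition qpoch_inf :: "real \<Rightarrow> real \<Rightarrow> real" where
  "qpoch_inf a q = (\<Prod>k. 1 - a * q ^ k)"

text \<open>
  The Hahn--Exton q-Bessel function is polymorphic, so that it can be used both as a function of a
  real variable (for its derivatives on the positive axis) and, with the principal branch of the
  powers, as a function of a complex variable. As \<open>0 powr 0 = 0\<close>, its value at \<open>0\<close> is \<open>0\<close>, which
  for \<open>\<nu> \<le> 0\<close> is not the limit there; below, only nonzero arguments matter, as the other factors of
  \<open>hahn_exton_h\<close> already give the correct value \<open>0\<close> at \<open>0\<close>.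
\<close>

definition hahn_exton_J :: "real \<Rightarrow> real \<Rightarrow> 'a \<Rightarrow> 'a::{real_normed_field, ln}" where
  "hahn_exton_J \<nu> q z =
     of_real (qpoch_inf (q powr (\<nu> + 1)) q / qpoch_inf q q) *
     (\<Sum>n. (-1) ^ n * z powr of_real (2 * real n + \<nu>) /
            of_real (qpoch q q n * qpoch (q powr (\<nu> + 1)) q n) *
            of_real (q ^ (n * (n + 1) div 2)))"

definition hahn_exton_c :: "real \<Rightarrow> real \<Rightarrow> real" where
  "hahn_exton_c \<nu> q = qpoch_inf q q / qpoch_inf (q powr (\<nu> + 1)) q"

text \<open>
  With principal branches the multivalued factors cancel at every point, including the branch cut
  and \<open>0\<close>, so this is the entire function given by the power series in
  \<open>hahn_exton_h_power_series\<close> below.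
\<close>

definition hahn_exton_h :: "real \<Rightarrow> real \<Rightarrow> complex \<Rightarrow> complex" where
  "hahn_exton_h \<nu> q z =
     of_real (hahn_exton_c \<nu> q) * z powr of_real (1 - \<nu> / 2) * hahn_exton_J \<nu> q (csqrt z)"

text \<open>
  The condition \<open>deriv f z \<noteq> 0\<close> is needed because division by zero yields zero. The supremum is
  taken in the extended reals, so that it is meaningful for unbounded sets of radii.
\<close>

definition radius_of_convexity :: "(complex \<Rightarrow> complex) \<Rightarrow> ereal" where
  "radius_of_convexity f =
     (SUP r\<in>{r::real. 0 < r \<and>
               (\<forall>z\<in>ball 0 r. deriv f z \<noteq> 0 \<and> Re (1 + z * deriv (deriv f) z / deriv f z) > 0)}.
        ereal r)"

definition smallest_positive_root :: "(real \<Rightarrow> real) \<Rightarrow> real \<Rightarrow> bool" where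
  "smallest_positive_root F r \<longleftrightarrow> 0 < r \<and> F r = 0 \<and> (\<forall>s. 0 < s \<and> F s = 0 \<longrightarrow> r \<le> s)"

definition E_poly :: "real \<Rightarrow> real \<Rightarrow> real" where
  "E_poly \<nu> q = 8 * q powr (\<nu> + 3) - q powr (\<nu> + 2) + q - 8"

definition K_poly :: "real \<Rightarrow> real \<Rightarrow> real" where
  "K_poly \<nu> q =
     5 * q + 11 * q powr (\<nu> + 2) - 21 * q powr (\<nu> + 3) - 34 * q powr (\<nu> + 4)
     - 21 * q powr (\<nu> + 5) + 11 * q powr (\<nu> + 6)"

definition L_poly :: "real \<Rightarrow> real \<Rightarrow> real" where
  "L_poly \<nu> q =
     q powr (2 * \<nu> + 5) + 5 * q powr (2 * \<nu> + 6) + 5 * q powr (2 * \<nu> + 7)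
     + 16 * q powr (2 * \<nu> + 8) + 5 * q ^ 2 + q ^ 3 + 16"

definition T_poly :: "real \<Rightarrow> real" where
  "T_poly q = (q - 1) * (q ^ 3 + 2 * q ^ 2 + 2 * q + 1)"

lemma qpoch_inf_nonzero:
  assumes "0 < q" "q < 1" "0 < a" "a < 1"
  shows "qpoch_inf a q \<noteq> 0"
proof -
  have lt: "a * q ^ k < 1" for k
  proof -
    have "q ^ k \<le> 1" using assms by (simp add: power_le_one)
    hence "a * q ^ k \<le> a" using assms by (simp add: mult_left_le)
    thus ?thesis using assms by linarith
  qed
  have "summable (\<lambda>k. norm (- (a * q ^ k)))"
    using assms by (simp add: abs_mult power_abs summable_geometric summable_mult)
  hence "abs_convergent_prod (\<lambda>k. 1 + - (a * q ^ k))"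
    by (intro summable_imp_abs_convergent_prod) simp
  hence "convergent_prod (\<lambda>k. 1 - a * q ^ k)"
    using abs_convergent_prod_imp_convergent_prod by fastforce
  thus ?thesis
    unfolding qpoch_inf_def using lt prodinf_nonzero[of "\<lambda>k. 1 - a * q ^ k"]
    by (metis diff_gt_0_iff_gt less_irrefl)
qed

lemma powr_times_csqrt_powr:
  fixes z :: complex
  shows "z powr of_real (1 - \<nu> / 2) * csqrt z powr of_real (2 * real n + \<nu>) = z ^ (n + 1)"
proof (cases "z = 0")
  case False
  have "- (pi / 2) < Im (Ln z / 2)" "Im (Ln z / 2) \<le> pi / 2"
    using mpi_less_Im_Ln[OF False] Im_Ln_le_pi[OF False] by auto
  hence "Ln (exp (Ln z / 2)) = Ln z / 2"
    using pi_gt_zero by (intro Ln_exp) linarith+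
  moreover have "csqrt z = exp (Ln z / 2)"
    using False by (rule csqrt_exp_Ln)
  ultimately have *: "Ln (csqrt z) = Ln z / 2" by simp
  have "z powr of_real (1 - \<nu> / 2) * csqrt z powr of_real (2 * real n + \<nu>) =
        exp (of_nat (n + 1) * Ln z)"
    using False by (simp add: powr_def * exp_add[symmetric] algebra_simps add_divide_distrib)
  also have "\<dots> = z ^ (n + 1)"
    using False by (metis exp_Ln exp_of_nat_mult)
  finally show ?thesis .
qed simp

lemma qpoch_Suc: "qpoch a q (Suc n) = qpoch a q n * (1 - a * q ^ n)"
  by (simp add: qpoch_def)

lemma hahn_exton_series_summable:
  fixes z :: complex
  assumes "0 < q" "q < 1" "0 < a" "a < 1"
  shows "summable (\<lambda>n. of_real ((-1) ^ n * q ^ (n * (n + 1) div 2) /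
             (qpoch q q n * qpoch a q n)) * z ^ (n + 1))"
    (is "summable ?f")
proof -
  define M where "M = (1 - q) * (1 - a)"
  have "M > 0" using assms by (simp add: M_def)
  have "(\<lambda>n. q ^ Suc n * norm z / M) \<longlonglongrightarrow> 0 * norm z / M"
    using assms \<open>M > 0\<close> by (intro tendsto_intros LIMSEQ_Suc LIMSEQ_power_zero) auto
  hence "eventually (\<lambda>n. q ^ Suc n * norm z / M < 1 / 2) sequentially"
    by (intro order_tendstoD(2)) auto
  then obtain N where N: "\<And>n. n \<ge> N \<Longrightarrow> q ^ Suc n * norm z / M < 1 / 2"
    unfolding eventually_sequentially by blast
  show ?thesis
  proof (rule summable_ratio_test[of "1 / 2" N])
    fix n assume "n \<ge> N"
    define D where "D = (1 - q * q ^ n) * (1 - a * q ^ n)"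
    have "q ^ n \<le> 1" using assms by (simp add: power_le_one)
    hence "q * q ^ n \<le> q" "a * q ^ n \<le> a"
      using assms mult_left_mono[of "q ^ n" 1 q] mult_left_mono[of "q ^ n" 1 a] by auto
    hence "M \<le> D"
      unfolding M_def D_def using assms by (intro mult_mono) linarith+
    have e: "Suc n * (Suc n + 1) div 2 = n * (n + 1) div 2 + Suc n"
    proof -
      have "Suc n * (Suc n + 1) = n * (n + 1) + Suc n * 2" by simp
      thus ?thesis by (metis div_mult_self1 zero_neq_numeral add.commute)
    qed
    have "?f (Suc n) = of_real (- (q ^ Suc n) / D) * z * ?f n"
      by (simp only: e power_add qpoch_Suc D_def) (simp add: mult_ac)
    hence "norm (?f (Suc n)) = q ^ Suc n * norm z / D * norm (?f n)"
      using assms \<open>M > 0\<close> \<open>M \<le> D\<close>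
      by (simp only: norm_mult norm_of_real) (simp add: abs_mult power_abs)
    also have "\<dots> \<le> q ^ Suc n * norm z / M * norm (?f n)"
      using assms \<open>M > 0\<close> \<open>M \<le> D\<close>
      by (intro mult_right_mono divide_left_mono) auto
    also have "\<dots> \<le> 1 / 2 * norm (?f n)"
      using N[OF \<open>n \<ge> N\<close>] by (intro mult_right_mono) auto
    finally show "norm (?f (Suc n)) \<le> 1 / 2 * norm (?f n)" .
  qed simp
qed

lemma hahn_exton_h_power_series:
  assumes "\<nu> > -1" "0 < q" "q < 1"
  shows "hahn_exton_h \<nu> q z =
    (\<Sum>n. of_real ((-1) ^ n * q ^ (n * (n + 1) div 2) /
             (qpoch q q n * qpoch (q powr (\<nu> + 1)) q n)) * z ^ (n + 1))"
proof -
  define C where "C = qpoch_inf (q powr (\<nu> + 1)) q / qpoch_inf q q"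
  define b where "b = (\<lambda>n. of_real ((-1) ^ n * q ^ (n * (n + 1) div 2) /
                        (qpoch q q n * qpoch (q powr (\<nu> + 1)) q n)) :: complex)"
  have "q powr (\<nu> + 1) < 1"
    using assms powr_less_mono'[of q 0 "\<nu> + 1"] by simp
  hence "qpoch_inf q q \<noteq> 0" "qpoch_inf (q powr (\<nu> + 1)) q \<noteq> 0"
    using assms by (simp_all add: qpoch_inf_nonzero)
  hence C: "hahn_exton_c \<nu> q * C = 1"
    by (simp add: hahn_exton_c_def C_def)
  have J: "hahn_exton_J \<nu> q (csqrt z) =
      of_real C * (\<Sum>n. b n * csqrt z powr of_real (2 * real n + \<nu>))"
    by (simp add: hahn_exton_J_def C_def b_def mult_ac)
  have "hahn_exton_h \<nu> q z =
      of_real (hahn_exton_c \<nu> q * C) *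
      (z powr of_real (1 - \<nu> / 2) * (\<Sum>n. b n * csqrt z powr of_real (2 * real n + \<nu>)))"
    by (simp only: hahn_exton_h_def J of_real_mult mult_ac)
  also have "\<dots> = z powr of_real (1 - \<nu> / 2) * (\<Sum>n. b n * csqrt z powr of_real (2 * real n + \<nu>))"
    by (simp add: C)
  also have "\<dots> = (\<Sum>n. b n * z ^ (n + 1))"
  proof (cases "z = 0")
    case False
    define p where "p = z powr of_real (1 - \<nu> / 2)"
    have "p \<noteq> 0" using False by (simp add: p_def)
    have term_eq: "p * (b n * csqrt z powr of_real (2 * real n + \<nu>)) = b n * z ^ (n + 1)" for n
      using powr_times_csqrt_powr[of z \<nu> n] unfolding p_def by (metis mult.left_commute)
    have "summable (\<lambda>n. b n * z ^ (n + 1))"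
      unfolding b_def using assms \<open>q powr (\<nu> + 1) < 1\<close>
      by (intro hahn_exton_series_summable) auto
    hence "summable (\<lambda>n. p * (b n * csqrt z powr of_real (2 * real n + \<nu>)))"
      by (simp only: term_eq)
    hence "summable (\<lambda>n. b n * csqrt z powr of_real (2 * real n + \<nu>))"
      using \<open>p \<noteq> 0\<close> by (simp only: summable_cmult_iff) simp
    from suminf_mult[OF this, of p] show ?thesis
      by (simp only: term_eq flip: p_def)
  qed simp
  finally show ?thesis by (simp only: b_def)
qed

end

theory Submission
  imports Defs
begin

text \<open>
  Put \<open>a = q powr (\<nu> + 1)\<close>, let \<open>b k\<close> be the coefficients of \<open>h(z) = (\<Sum>k. b k * z ^ (k + 1))\<close>, and let
  \<open>H = h'\<close> and \<open>G = (z h')'\<close>, whose coefficients are \<open>(k + 1) * b k\<close> and \<open>(k + 1)^2 * b k\<close>. Then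
  \<open>1 + z h'' / h' = G / H\<close>. Everything rests on the fact that \<open>H\<close> and \<open>G\<close> behave like products
  \<open>\<Prod>i. 1 - x i * z\<close> with \<open>x i > 0\<close>. For such an \<open>H\<close> one has
  \<open>G / H = 1 - (\<Sum>i. x i * z / (1 - x i * z))\<close>, so that on a circle \<open>|z| = r\<close> inside the zero-free disc the real
  part is smallest at \<open>z = r\<close>; hence the radius of convexity is the first positive zero \<open>\<gamma>\<close> of \<open>G\<close>.
  Writing \<open>h\<close> through \<open>J(sqrt r)\<close> turns \<open>G(r) = 0\<close> into the stated equation.

  Real-rootedness is obtained without a Hadamard factorization, by approximating with polynomials.
  The q-binomial theorem expands \<open>\<Prod>j<N. 1 - q ^ (j + 1) * z\<close>, and the operators \<open>f(z) - c f(q z)\<close> with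
  \<open>0 < c < 1\<close> multiply the \<open>k\<close>-th coefficient by \<open>1 - c q ^ k\<close>. They keep the zeros positive as long as
  consecutive zeros have quotient at least \<open>1 / q\<close>, and they preserve that separation
  (\<open>q_difference_root_prod\<close>). Using \<open>N\<close> of them with \<open>c = a, a q, a q^2, \<dots>\<close> produces polynomials
  whose coefficients are those of \<open>h(z) / z\<close> times factors in \<open>[0, 1]\<close> that tend to \<open>1\<close>
  (\<open>hahn_exton_approximants_separated\<close>), and Rolle's theorem applied to \<open>z p(z)\<close> passes from there to
  \<open>H\<close> and \<open>G\<close>.

  The inequalities are Euler--Rayleigh inequalities. If \<open>p j\<close> is the limit of the power sums of
  exponent \<open>j\<close> of the reciprocal zeros of the approximants of \<open>G\<close>, Newton's identities express \<open>p j\<close>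
  through the coefficients, and \<open>p j powr (- 1 / j) \<le> \<gamma> \<le> p j / p (j + 1)\<close>. An equality would propagate to
  \<open>\<gamma> * p (j + 1) = p j\<close> for all \<open>j \<ge> 2\<close>. This means that \<open>G\<close> is of the form \<open>exp (- c z) (1 - z / \<gamma>) ^ m\<close>,
  whose coefficients satisfy a recurrence incompatible with the decay of the actual ones
  (\<open>power_sum_not_geometric\<close>). The four bounds are the cases \<open>j = 1\<close> and \<open>j = 2\<close>
  (\<open>power_sums_first_zero\<close>), and their closed forms are computed in \<open>bounds_in_terms_of_power_sums\<close>.
\<close>

section \<open>Polynomials with positive zeros\<close>

text \<open>
  The parameters \<open>x i\<close> are the reciprocals of the zeros: constant term \<open>1\<close> is then built in, and it is the
  reciprocals whose power sums stay bounded when the degree grows.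
\<close>

definition root_prod :: "(nat \<Rightarrow> real) \<Rightarrow> nat \<Rightarrow> 'a::{real_algebra_1, comm_ring_1} poly" where
  "root_prod x n = (\<Prod>i<n. [:1, - of_real (x i):])"

lemma poly_root_prod: "poly (root_prod x n) z = (\<Prod>i<n. 1 - of_real (x i) * z)"
  by (simp add: root_prod_def poly_prod mult.commute)

lemma root_prod_Suc: "root_prod x (Suc n) = root_prod x n * [:1, - of_real (x n):]"
  by (simp add: root_prod_def)

lemma coeff_root_prod_Suc:
  "coeff (root_prod x (Suc n)) k =
     coeff (root_prod x n) k - of_real (x n) * (case k of 0 \<Rightarrow> 0 | Suc j \<Rightarrow> coeff (root_prod x n) j)"
proof -
  have "root_prod x (Suc n) = root_prod x n + pCons 0 (smult (- of_real (x n)) (root_prod x n))"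
    unfolding root_prod_Suc by simp
  hence "coeff (root_prod x (Suc n)) k =
      coeff (root_prod x n + pCons 0 (smult (- of_real (x n)) (root_prod x n))) k"
    by (rule arg_cong)
  thus ?thesis by (cases k) simp_all
qed

lemma coeff_root_prod_of_real:
  "coeff (root_prod x n :: 'a::{real_algebra_1, comm_ring_1} poly) k =
     of_real (coeff (root_prod x n :: real poly) k)"
proof (induction n arbitrary: k)
  case 0
  show ?case by (simp add: root_prod_def)
next
  case (Suc n)
  thus ?case by (simp add: coeff_root_prod_Suc split: nat.split)
qed

lemma degree_root_prod_le: "degree (root_prod x n :: 'a::{real_algebra_1, comm_ring_1} poly) \<le> n"
proof -
  have "degree (root_prod x n :: 'a poly) \<le>
      sum (degree \<circ> (\<lambda>i. [:1, - of_real (x i):] :: 'a poly)) {..<n}"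
    unfolding root_prod_def by (rule degree_prod_sum_le) simp
  also have "\<dots> \<le> (\<Sum>i<n. 1)"
    by (intro sum_mono) simp
  finally show ?thesis by simp
qed

lemma root_prod_sums:
  fixes z :: "'a::{real_normed_field}"
  shows "(\<lambda>k. of_real (coeff (root_prod x n) k) * z ^ k) sums (\<Prod>i<n. 1 - of_real (x i) * z)"
proof -
  have "(\<lambda>k. coeff (root_prod x n) k * z ^ k) sums
      (\<Sum>k\<le>degree (root_prod x n :: 'a poly). coeff (root_prod x n) k * z ^ k)"
    by (rule sums_finite) (auto simp: coeff_eq_0)
  thus ?thesis
    unfolding poly_root_prod[symmetric] poly_altdef coeff_root_prod_of_real[where 'a='a, symmetric] .
qed

lemma poly_eq_root_prod:
  fixes p :: "real poly"
  assumes "degree p \<le> n" "poly p 0 = 1" "inj_on r {..<n}"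
    and "\<And>i. i < n \<Longrightarrow> 0 < r i \<and> poly p (r i) = 0"
  shows "p = root_prod (\<lambda>i. 1 / r i) n"
proof (rule poly_eqI_degree)
  have "card (insert 0 (r ` {..<n})) = Suc n"
  proof -
    have "0 \<notin> r ` {..<n}" using assms(4) by force
    thus ?thesis using card_image[OF assms(3)] by simp
  qed
  thus "degree p < card (insert 0 (r ` {..<n}))"
    "degree (root_prod (\<lambda>i. 1 / r i) n :: real poly) < card (insert 0 (r ` {..<n}))"
    using assms(1) degree_root_prod_le[where 'a=real, of "\<lambda>i. 1 / r i" n] by simp_all
next
  fix t assume "t \<in> insert 0 (r ` {..<n})"
  then consider "t = 0" | i where "i < n" "t = r i" by auto
  thus "poly p t = poly (root_prod (\<lambda>i. 1 / r i) n) t"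
  proof cases
    case 1
    thus ?thesis using assms(2) by (simp add: poly_root_prod)
  next
    case 2
    have "(\<Prod>i<n. 1 - of_real (1 / r i) * t) = 0"
      using 2 assms(4)[of i] by (intro prod_zero bexI[of _ i]) auto
    thus ?thesis using 2 assms(4)[of i] by (simp add: poly_root_prod)
  qed
qed

text \<open>
  The weak inequalities matter: zeros in exact geometric progression, the starting point of the
  construction, make evaluation points collide with zeros.
\<close>

lemma sign_root_prod:
  fixes x :: "nat \<Rightarrow> real"
  assumes "i \<le> n" "\<And>j. j < i \<Longrightarrow> 1 \<le> x j * t" "\<And>j. i \<le> j \<Longrightarrow> j < n \<Longrightarrow> x j * t \<le> 1"
  shows "0 \<le> (-1) ^ i * poly (root_prod x n) t"
  using assms
proof (induction n arbitrary: i)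
  case 0
  thus ?case by (simp add: root_prod_def)
next
  case (Suc n)
  show ?case
  proof (cases "i = Suc n")
    case True
    have "0 \<le> (-1) ^ n * poly (root_prod x n) t"
      using Suc.prems True by (intro Suc.IH) auto
    moreover have "0 \<le> x n * t - 1" using Suc.prems True by simp
    ultimately have "0 \<le> ((-1) ^ n * poly (root_prod x n) t) * (x n * t - 1)"
      by (rule mult_nonneg_nonneg)
    thus ?thesis using True by (simp add: poly_root_prod algebra_simps)
  next
    case False
    have "0 \<le> (-1) ^ i * poly (root_prod x n) t"
      using Suc.prems False by (intro Suc.IH) auto
    moreover have "0 \<le> 1 - x n * t" using Suc.prems False by simp
    ultimately have "0 \<le> ((-1) ^ i * poly (root_prod x n) t) * (1 - x n * t)"
      by (rule mult_nonneg_nonneg)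
    thus ?thesis by (simp add: poly_root_prod mult_ac)
  qed
qed

definition separated :: "real \<Rightarrow> (nat \<Rightarrow> real) \<Rightarrow> nat \<Rightarrow> bool" where
  "separated q x n \<longleftrightarrow> (\<forall>i<n. 0 < x i) \<and> (\<forall>i j. i < j \<longrightarrow> j < n \<longrightarrow> x j \<le> q * x i)"

text \<open>
  Let \<open>f\<close> be the product with parameters \<open>x\<close>. By separation the zeros of \<open>f(t)\<close> and of \<open>f(q t)\<close>
  alternate, \<open>1 / x 0 < 1 / (q * x 0) \<le> 1 / x 1 < 1 / (q * x 1) \<le> \<dots>\<close>. At \<open>1 / (q * x (i - 1))\<close> only \<open>f(t)\<close>
  and at \<open>1 / x i\<close> only \<open>- c f(q t)\<close> contributes to the difference, with opposite signs. This puts one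
  zero into each interval \<open>[1 / (q * x (i - 1)), 1 / x i]\<close>, and these intervals are themselves apart by a
  factor \<open>1 / q\<close>.
\<close>

lemma q_difference_root_prod:
  assumes q: "0 < q" "q < 1" and c: "0 < c" "c < 1" and sep: "separated q x n"
  obtains y where "separated q y n"
    "\<And>k. coeff (root_prod y n) k = (1 - c * q ^ k) / (1 - c) * coeff (root_prod x n :: real poly) k"
proof -
  define p :: "real poly" where "p = root_prod x n"
  define g where "g = smult (1 / (1 - c)) (p - smult c (pcompose p [:0, q:]))"
  have pos: "0 < x i" if "i < n" for i using sep that by (simp add: separated_def)
  have le: "x j \<le> q * x i" if "i < j" "j < n" for i j using sep that by (simp add: separated_def)
  have le': "x j \<le> x i" if "i \<le> j" "j < n" for i j
  proof (cases "i = j")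
    case False
    hence "x j \<le> q * x i" using that by (intro le) auto
    also have "\<dots> \<le> 1 * x i" using q pos[of i] that by (intro mult_right_mono) auto
    finally show ?thesis by simp
  qed simp
  have coeff_g: "coeff g k = (1 - c * q ^ k) / (1 - c) * coeff p k" for k
    using c by (simp add: g_def coeff_pcompose_linear field_simps)
  have g: "poly g t = (poly p t - c * poly p (q * t)) / (1 - c)" for t
    by (simp add: g_def poly_pcompose mult.commute)
  have zero: "poly p (1 / x i) = 0" if "i < n" for i
    unfolding p_def poly_root_prod using that pos[OF that] by (intro prod_zero) auto
  have g0: "poly g 0 = 1"
    using c by (simp add: g) (simp add: p_def poly_root_prod)
  have "degree p \<le> n" unfolding p_def by (rule degree_root_prod_le)
  hence deg: "degree g \<le> n"
    by (intro degree_le) (auto simp: coeff_g coeff_eq_0)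
  (* The case distinction at i = 0 replaces the missing left neighbour by 0, where g is 1. *)
  define lo where "lo i = (if i = 0 then 0 else 1 / (q * x (i - 1)))" for i
  have "\<exists>r. lo i \<le> r \<and> r \<le> 1 / x i \<and> poly g r = 0" if i: "i < n" for i
  proof -
    have up: "(-1) ^ i * poly g (1 / x i) \<le> 0"
    proof -
      have "0 \<le> (-1) ^ i * poly p (q * (1 / x i))"
        unfolding p_def
      proof (rule sign_root_prod)
        fix j assume "j < i"
        thus "1 \<le> x j * (q * (1 / x i))"
          using le[of j i] pos[OF i] i by (simp add: field_simps)
      next
        fix j assume "i \<le> j" "j < n"
        hence "x j * q \<le> x i * 1" using le'[of i j] pos[OF i] q by (intro mult_mono) auto
        thus "x j * (q * (1 / x i)) \<le> 1" using pos[OF i] by (simp add: field_simps)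
      qed (use i in simp)
      moreover have "(-1) ^ i * poly g (1 / x i) =
          - (c / (1 - c)) * ((-1) ^ i * poly p (q * (1 / x i)))"
        unfolding g zero[OF i] by simp
      ultimately show ?thesis
        using c by (metis divide_nonneg_pos diff_gt_0_iff_gt less_imp_le minus_mult_left
            mult_nonneg_nonneg neg_le_0_iff_le)
    qed
    have low: "0 \<le> (-1) ^ i * poly g (lo i)"
    proof (cases i)
      case 0
      thus ?thesis using g0 by (simp add: lo_def)
    next
      case (Suc l)
      have l: "l < n" using i Suc by simp
      have t: "lo i = 1 / (q * x l)" by (simp add: lo_def Suc)
      have "q * lo i = 1 / x l" using q by (simp add: t)
      hence "poly p (q * lo i) = 0" using zero[OF l] by simp
      moreover have "0 \<le> (-1) ^ i * poly p (lo i)"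
        unfolding p_def
      proof (rule sign_root_prod)
        fix j assume "j < i"
        hence "q * x l \<le> 1 * x j" using le'[of j l] pos[OF l] q l Suc by (intro mult_mono) auto
        thus "1 \<le> x j * lo i" using pos[OF l] q by (simp add: t field_simps)
      next
        fix j assume "i \<le> j" "j < n"
        hence "x j \<le> q * x l" using Suc by (intro le) auto
        thus "x j * lo i \<le> 1" using pos[OF l] q unfolding t by (simp add: field_simps)
      qed (use i in simp)
      ultimately show ?thesis using c by (simp add: g)
    qed
    have "lo i \<le> 1 / x i"
    proof (cases i)
      case 0
      thus ?thesis using pos[OF i] by (simp add: lo_def)
    next
      case (Suc l)
      thus ?thesis using le[of l i] pos[OF i] pos[of l] i q
        by (auto simp: lo_def intro!: divide_left_mono mult_pos_pos)
    qed
    then obtain r where "lo i \<le> r" "r \<le> 1 / x i" "(-1) ^ i * poly g r = 0"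
      using IVT2[of "\<lambda>t. (-1) ^ i * poly g t" "1 / x i" 0 "lo i", OF up low] by auto
    thus ?thesis by auto
  qed
  then obtain r where r: "\<And>i. i < n \<Longrightarrow> lo i \<le> r i" "\<And>i. i < n \<Longrightarrow> r i \<le> 1 / x i"
      "\<And>i. i < n \<Longrightarrow> poly g (r i) = 0"
    by metis
  have rpos: "0 < r i" if "i < n" for i
  proof -
    have "0 \<le> lo i" using q pos[of "i - 1"] that by (auto simp: lo_def intro!: less_imp_le)
    hence "0 \<le> r i" using r(1)[OF that] by simp
    moreover have "r i \<noteq> 0" using g0 r(3)[OF that] by auto
    ultimately show ?thesis by simp
  qed
  have rsep: "r i \<le> q * r j" if "i < j" "j < n" for i j
  proof -
    have "x (j - 1) \<le> x i" using that by (intro le') auto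
    moreover have "0 < x (j - 1)" using that pos by simp
    ultimately have "1 / x i \<le> 1 / x (j - 1)" by (intro divide_left_mono) auto
    also have "\<dots> = q * lo j" using that q by (simp add: lo_def)
    also have "\<dots> \<le> q * r j" using r(1) that q by simp
    finally show ?thesis using r(2)[of i] that by simp
  qed
  have "r i \<noteq> r j" if "i < j" "j < n" for i j
  proof -
    have "q * r j < 1 * r j" using q rpos that by (intro mult_strict_right_mono) auto
    thus ?thesis using rsep[OF that] by simp
  qed
  hence "inj_on r {..<n}" by (intro linorder_inj_onI) auto
  hence "g = root_prod (\<lambda>i. 1 / r i) n"
    using deg g0 r(3) rpos by (intro poly_eq_root_prod) auto
  hence "coeff (root_prod (\<lambda>i. 1 / r i) n) k = (1 - c * q ^ k) / (1 - c) * coeff p k" for k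
    using coeff_g by simp
  moreover have "separated q (\<lambda>i. 1 / r i) n"
    unfolding separated_def using rpos rsep by (auto simp: field_simps)
  ultimately show ?thesis unfolding p_def by (intro that)
qed

text \<open>
  Rolle's theorem between consecutive zeros of \<open>z p(z)\<close>, the first of which is \<open>0\<close>. The derivative of
  \<open>z p(z)\<close> has coefficients \<open>(k + 1) * coeff p k\<close>.
\<close>

lemma pderiv_root_prod:
  assumes "\<forall>i<n. 0 < x i" and "\<forall>i j. i < j \<longrightarrow> j < n \<longrightarrow> x j < x i"
  shows "\<exists>y. (\<forall>i<n. 0 < y i) \<and> (\<forall>i j. i < j \<longrightarrow> j < n \<longrightarrow> y j < y i) \<and>
    (\<forall>k. coeff (root_prod y n) k = real (Suc k) * coeff (root_prod x n :: real poly) k)"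
proof -
  note pos = assms(1)[rule_format] and dec = assms(2)[rule_format]
  define p :: "real poly" where "p = root_prod x n"
  define g where "g = pderiv (pCons 0 p)"
  have coeff_g: "coeff g k = real (Suc k) * coeff p k" for k
    by (simp add: g_def coeff_pderiv del: of_nat_Suc)
  have "degree p \<le> n" unfolding p_def by (rule degree_root_prod_le)
  hence deg: "degree g \<le> n"
    by (intro degree_le) (auto simp: coeff_g coeff_eq_0)
  have g0: "poly g 0 = 1"
    by (simp add: g_def pderiv_pCons) (simp add: p_def poly_root_prod)
  define s where "s i = (case i of 0 \<Rightarrow> 0 | Suc l \<Rightarrow> 1 / x l)" for i
  have s_zero: "poly (pCons 0 p) (s i) = 0" if "i \<le> n" for i
  proof (cases i)
    case (Suc l)
    have "poly p (1 / x l) = 0"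
      unfolding p_def poly_root_prod using that pos[of l] Suc by (intro prod_zero) auto
    thus ?thesis by (simp add: s_def Suc)
  qed (simp add: s_def)
  have s_less: "s i < s j" if ij: "i < j" "j \<le> n" for i j
  proof (cases i)
    case 0
    thus ?thesis using ij pos[of "j - 1"] by (auto simp: s_def split: nat.split)
  next
    case (Suc l)
    obtain m where m: "j = Suc m" using ij by (cases j) auto
    have "1 / x l < 1 / x m"
      using ij Suc m pos[of m] pos[of l] dec[of l m] by (intro divide_strict_left_mono) auto
    thus ?thesis by (simp add: s_def Suc m)
  qed
  have "\<exists>r. s i < r \<and> r < s (Suc i) \<and> poly g r = 0" if "i < n" for i
  proof -
    have "\<exists>r. s i < r \<and> r < s (Suc i) \<and> DERIV (poly (pCons 0 p)) r :> 0"
      using that s_zero[of i] s_zero[of "Suc i"]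
      by (intro Rolle s_less) (auto intro!: continuous_intros)
    then obtain r where "s i < r" "r < s (Suc i)" "DERIV (poly (pCons 0 p)) r :> 0" by blast
    thus ?thesis using DERIV_unique[OF poly_DERIV] unfolding g_def by metis
  qed
  then obtain r where r: "\<And>i. i < n \<Longrightarrow> s i < r i" "\<And>i. i < n \<Longrightarrow> r i < s (Suc i)"
      "\<And>i. i < n \<Longrightarrow> poly g (r i) = 0"
    by metis
  have rpos: "0 < r i" if "i < n" for i
  proof -
    have "s 0 \<le> s i" using s_less[of 0 i] that by (cases "i = 0") auto
    moreover have "s 0 = 0" by (simp add: s_def)
    ultimately show ?thesis using r(1)[OF that] by linarith
  qed
  have rless: "r i < r j" if "i < j" "j < n" for i j
  proof -
    have "s (Suc i) \<le> s j" using s_less[of "Suc i" j] that by (cases "Suc i = j") auto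
    thus ?thesis using r(2)[of i] r(1)[of j] that by simp
  qed
  hence "r i \<noteq> r j" if "i < j" "j < n" for i j using that by fastforce
  hence "inj_on r {..<n}" by (intro linorder_inj_onI) auto
  hence "g = root_prod (\<lambda>i. 1 / r i) n"
    using deg g0 r(3) rpos by (intro poly_eq_root_prod) auto
  hence "coeff (root_prod (\<lambda>i. 1 / r i) n) k = real (Suc k) * coeff p k" for k
    using coeff_g by metis
  hence coeffs: "\<forall>k. coeff (root_prod (\<lambda>i. 1 / r i) n) k =
      real (Suc k) * coeff (root_prod x n :: real poly) k"
    unfolding p_def by (rule allI)
  have "1 / r j < 1 / r i" if "i < j" "j < n" for i j
    using rless[OF that] rpos[of i] rpos[of j] that by (intro divide_strict_left_mono) auto
  hence dec: "\<forall>i j. i < j \<longrightarrow> j < n \<longrightarrow> 1 / r j < 1 / r i" by (intro allI impI)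
  show ?thesis
    by (intro exI[of _ "\<lambda>i. 1 / r i"] conjI coeffs dec) (simp add: rpos)
qed

section \<open>Approximating polynomials for the Hahn--Exton series\<close>

definition hahn_exton_coeff :: "real \<Rightarrow> real \<Rightarrow> nat \<Rightarrow> real" where
  "hahn_exton_coeff a q k = (-1) ^ k * q ^ (k * (k + 1) div 2) / (qpoch q q k * qpoch a q k)"

abbreviation derivative_coeff :: "real \<Rightarrow> real \<Rightarrow> nat \<Rightarrow> real" where
  "derivative_coeff a q \<equiv> \<lambda>k. real (Suc k) * hahn_exton_coeff a q k"

abbreviation convexity_coeff :: "real \<Rightarrow> real \<Rightarrow> nat \<Rightarrow> real" where
  "convexity_coeff a q \<equiv> \<lambda>k. real (Suc k) ^ 2 * hahn_exton_coeff a q k"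

text \<open>
  Both factors come from finite products: the first is \<open>(q; q)_N / (q; q)_(N - k)\<close> from the
  q-binomial coefficient, the second is \<open>(a q^k; q)_N / (a; q)_N\<close> multiplied by \<open>(a; q)_k\<close>. For
  \<open>k > N\<close> the truncated subtraction makes the factor \<open>j = N\<close> vanish, so the product is the coefficient
  factor for every \<open>k\<close>.
\<close>

definition damping :: "real \<Rightarrow> real \<Rightarrow> nat \<Rightarrow> nat \<Rightarrow> real" where
  "damping a q N k = (\<Prod>j<k. (1 - q ^ (N - j)) * (1 - a * q ^ (N + j)))"

lemma qpoch_eq_prod_lessThan: "qpoch a q n = (\<Prod>j<n. 1 - a * q ^ j)"
  by (induction n) (simp_all add: qpoch_Suc, simp add: qpoch_def)

lemma mult_power_less_one:
  fixes a q :: real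
  assumes "0 < q" "q < 1" "0 < a" "a < 1"
  shows "a * q ^ k < 1"
proof -
  have "a * q ^ k \<le> a * 1"
    using assms by (intro mult_left_mono power_le_one) auto
  also have "\<dots> < 1" using assms by simp
  finally show ?thesis .
qed

lemma qpoch_pos:
  assumes "0 < q" "q < 1" "0 < a" "a < 1"
  shows "0 < qpoch a q n"
  unfolding qpoch_eq_prod_lessThan using mult_power_less_one[OF assms] by (intro prod_pos) auto

lemma triangle_Suc: "Suc k * (Suc k + 1) div 2 = k * (k + 1) div 2 + Suc k"
proof -
  have "Suc k * (Suc k + 1) = k * (k + 1) + Suc k * 2" by simp
  thus ?thesis by (metis div_mult_self1 zero_neq_numeral add.commute)
qed

lemma hahn_exton_coeff_Suc:
  "hahn_exton_coeff a q (Suc k) =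
     - (q ^ Suc k / ((1 - q ^ Suc k) * (1 - a * q ^ k))) * hahn_exton_coeff a q k"
  unfolding hahn_exton_coeff_def triangle_Suc qpoch_Suc by (simp add: power_add mult_ac)

lemma hahn_exton_coeff_nonzero:
  assumes "0 < q" "q < 1" "0 < a" "a < 1"
  shows "hahn_exton_coeff a q k \<noteq> 0"
  using assms qpoch_pos[of q q k] qpoch_pos[of q a k] by (simp add: hahn_exton_coeff_def)

text \<open>
  The q-binomial theorem, by induction on \<open>N\<close> with the q-Pascal rule.
\<close>

lemma coeff_root_prod_geometric:
  assumes "0 < q" "q < 1"
  shows "coeff (root_prod (\<lambda>j. q ^ Suc j) N :: real poly) k =
    (-1) ^ k * q ^ (k * (k + 1) div 2) / qpoch q q k * (\<Prod>j<k. 1 - q ^ (N - j))"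
proof (induction N arbitrary: k)
  case 0
  show ?case
    by (cases k) (simp_all add: root_prod_def qpoch_def coeff_pCons prod.lessThan_Suc)
next
  case (Suc N)
  define A where "A k = (-1) ^ k * q ^ (k * (k + 1) div 2) / qpoch q q k" for k
  define w where "w N k = (\<Prod>j<k. 1 - q ^ (N - j))" for N k
  show ?case
  proof (cases k)
    case 0
    thus ?thesis using Suc.IH[of 0] by (simp add: coeff_root_prod_Suc qpoch_def)
  next
    case (Suc l)
    have nz: "1 - q ^ Suc l \<noteq> 0"
      using assms power_Suc_less_one[of q l] by simp
    have A_Suc: "A (Suc l) * (1 - q ^ Suc l) = - (q ^ Suc l) * A l"
      unfolding A_def triangle_Suc qpoch_Suc using nz by (simp add: power_add)
    have w1: "w (Suc N) (Suc l) = (1 - q ^ Suc N) * w N l"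
      unfolding w_def prod.lessThan_Suc_shift by (simp del: power_Suc)
    have w2: "w N (Suc l) = (1 - q ^ (N - l)) * w N l"
      unfolding w_def by simp
    have eq: "(q ^ Suc l * q ^ (N - l) - q ^ Suc N) * w N l = 0"
    proof (cases "l \<le> N")
      case True
      hence "q ^ Suc l * q ^ (N - l) = q ^ Suc N"
        by (metis Suc_diff_le add_Suc le_add_diff_inverse power_add)
      thus ?thesis by simp
    next
      case False
      hence "w N l = 0"
        unfolding w_def by (intro prod_zero bexI[of _ N]) auto
      thus ?thesis by simp
    qed
    have "(A (Suc l) * w N (Suc l) - q ^ Suc N * (A l * w N l)) * (1 - q ^ Suc l) =
        (A (Suc l) * (1 - q ^ Suc l)) * w N (Suc l) - q ^ Suc N * (A l * w N l) * (1 - q ^ Suc l)"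
      by (simp add: algebra_simps)
    also have "\<dots> = - (q ^ Suc l) * A l * (1 - q ^ Suc N) * w N l +
        A l * ((q ^ Suc l * q ^ (N - l) - q ^ Suc N) * w N l)"
      unfolding A_Suc w2 by (simp add: algebra_simps)
    also have "\<dots> = (A (Suc l) * (1 - q ^ Suc l)) * w (Suc N) (Suc l)"
      unfolding A_Suc w1 eq by simp
    finally have "A (Suc l) * w N (Suc l) - q ^ Suc N * (A l * w N l) = A (Suc l) * w (Suc N) (Suc l)"
      using nz by (simp add: mult_ac)
    moreover have "coeff (root_prod (\<lambda>j. q ^ Suc j) N :: real poly) k = A k * w N k" for k
      unfolding A_def w_def by (rule Suc.IH)
    ultimately have "coeff (root_prod (\<lambda>j. q ^ Suc j) (Suc N) :: real poly) k = A k * w (Suc N) k"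
      unfolding coeff_root_prod_Suc Suc by simp
    thus ?thesis unfolding A_def w_def .
  qed
qed

text \<open>
  \<open>M\<close> counts the applications of \<open>f(z) - c f(q z)\<close>, the next one with \<open>c = a * q ^ M\<close>. Each of them
  replaces \<open>(a q^M; q)_k\<close> by \<open>(a q^(M + 1); q)_k\<close> up to normalization, which pushes the numerator
  towards \<open>1\<close> and leaves \<open>(a; q)_k\<close> in the denominator.
\<close>

lemma hahn_exton_approximants_separated:
  assumes "0 < q" "q < 1" "0 < a" "a < 1"
  shows "\<exists>x. separated q x N \<and> (\<forall>k. coeff (root_prod x N :: real poly) k =
    (-1) ^ k * q ^ (k * (k + 1) div 2) / (qpoch q q k * qpoch a q k) *
    (\<Prod>j<k. (1 - q ^ (N - j)) * (1 - a * q ^ (M + j))))"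
proof (induction M)
  case 0
  have "q ^ Suc j \<le> q * q ^ Suc i" if "i < j" for i j
  proof -
    have "q ^ j \<le> q ^ Suc i" using assms that by (intro power_decreasing) auto
    thus ?thesis using assms by simp
  qed
  hence "separated q (\<lambda>j. q ^ Suc j) N"
    using assms by (auto simp: separated_def)
  moreover have "coeff (root_prod (\<lambda>j. q ^ Suc j) N :: real poly) k =
    (-1) ^ k * q ^ (k * (k + 1) div 2) / (qpoch q q k * qpoch a q k) *
    (\<Prod>j<k. (1 - q ^ (N - j)) * (1 - a * q ^ (0 + j)))" for k
    unfolding coeff_root_prod_geometric[OF assms(1,2)] prod.distrib
    using qpoch_pos[OF assms, of k]
    by (simp add: qpoch_eq_prod_lessThan[symmetric])
  ultimately show ?case by blast
next
  case (Suc M)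
  define c where "c = a * q ^ M"
  have c: "0 < c" "c < 1" using mult_power_less_one[OF assms] assms by (simp_all add: c_def)
  obtain x where x: "separated q x N" "\<And>k. coeff (root_prod x N :: real poly) k =
    (-1) ^ k * q ^ (k * (k + 1) div 2) / (qpoch q q k * qpoch a q k) *
    (\<Prod>j<k. (1 - q ^ (N - j)) * (1 - a * q ^ (M + j)))"
    using Suc.IH by blast
  obtain y where y: "separated q y N"
    "\<And>k. coeff (root_prod y N) k = (1 - c * q ^ k) / (1 - c) * coeff (root_prod x N :: real poly) k"
    using q_difference_root_prod[OF assms(1,2) c x(1)] by blast
  have "(\<Prod>j<k. 1 - a * q ^ (Suc M + j)) = (1 - c * q ^ k) / (1 - c) * (\<Prod>j<k. 1 - a * q ^ (M + j))" for k
  proof -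
    have "(1 - c) * (\<Prod>j<k. 1 - a * q ^ (Suc M + j)) = (\<Prod>j<Suc k. 1 - a * q ^ (M + j))"
      unfolding prod.lessThan_Suc_shift by (simp add: c_def)
    also have "\<dots> = (1 - c * q ^ k) * (\<Prod>j<k. 1 - a * q ^ (M + j))"
      by (simp add: c_def power_add mult_ac)
    finally show ?thesis using c by (simp add: field_simps)
  qed
  hence "coeff (root_prod y N :: real poly) k =
    (-1) ^ k * q ^ (k * (k + 1) div 2) / (qpoch q q k * qpoch a q k) *
    (\<Prod>j<k. (1 - q ^ (N - j)) * (1 - a * q ^ (Suc M + j)))" for k
    unfolding y(2) x(2) prod.distrib by (simp add: mult_ac)
  thus ?case using y(1) by blast
qed

lemma hahn_exton_approximants:
  assumes "0 < q" "q < 1" "0 < a" "a < 1"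
  shows "\<exists>y. (\<forall>i<N. 0 < y i) \<and> (\<forall>k. coeff (root_prod y N :: real poly) k =
      damping a q N k * derivative_coeff a q k)"
    and "\<exists>x. (\<forall>i<N. 0 < x i) \<and> (\<forall>k. coeff (root_prod x N :: real poly) k =
      damping a q N k * convexity_coeff a q k)"
proof -
  obtain u where sep: "separated q u N" and
    u: "\<And>k. coeff (root_prod u N :: real poly) k = damping a q N k * hahn_exton_coeff a q k"
    using hahn_exton_approximants_separated[OF assms, of N N]
    unfolding damping_def hahn_exton_coeff_def mult.commute[of "prod _ _"] by blast
  have pos: "\<forall>i<N. 0 < u i" using sep by (simp add: separated_def)
  have "u j < u i" if "i < j" "j < N" for i j
  proof -
    have "u j \<le> q * u i" using sep that by (simp add: separated_def)
    also have "\<dots> < 1 * u i" using assms pos that by (intro mult_strict_right_mono) auto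
    finally show ?thesis by simp
  qed
  hence dec: "\<forall>i j. i < j \<longrightarrow> j < N \<longrightarrow> u j < u i" by blast
  obtain y where y: "\<forall>i<N. 0 < y i" "\<forall>i j. i < j \<longrightarrow> j < N \<longrightarrow> y j < y i"
    "\<forall>k. coeff (root_prod y N) k = real (Suc k) * coeff (root_prod u N :: real poly) k"
    using pderiv_root_prod[OF pos dec] by (elim exE conjE) (rule that)
  obtain x where x: "\<forall>i<N. 0 < x i" "\<forall>i j. i < j \<longrightarrow> j < N \<longrightarrow> x j < x i"
    "\<forall>k. coeff (root_prod x N) k = real (Suc k) * coeff (root_prod y N :: real poly) k"
    using pderiv_root_prod[OF y(1,2)] by (elim exE conjE) (rule that)
  have "\<forall>k. coeff (root_prod y N :: real poly) k = damping a q N k * derivative_coeff a q k"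
    unfolding y(3)[rule_format] u by (simp only: mult_ac simp_thms)
  thus "\<exists>y. (\<forall>i<N. 0 < y i) \<and> (\<forall>k. coeff (root_prod y N :: real poly) k =
      damping a q N k * derivative_coeff a q k)"
    using y(1) by (intro exI conjI)
  have "\<forall>k. coeff (root_prod x N :: real poly) k = damping a q N k * convexity_coeff a q k"
    unfolding x(3)[rule_format] y(3)[rule_format] u by (simp only: mult_ac power2_eq_square simp_thms)
  thus "\<exists>x. (\<forall>i<N. 0 < x i) \<and> (\<forall>k. coeff (root_prod x N :: real poly) k =
      damping a q N k * convexity_coeff a q k)"
    using x(1) by (intro exI conjI)
qed

lemma damping_bounds:
  assumes "0 < q" "q < 1" "0 < a" "a < 1"
  shows "0 \<le> damping a q N k" "damping a q N k \<le> 1"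
proof -
  have q: "0 \<le> 1 - q ^ n" "1 - q ^ n \<le> 1" for n
    using assms by (auto simp: power_le_one)
  have a: "0 \<le> 1 - a * q ^ n" "1 - a * q ^ n \<le> 1" for n
    using mult_power_less_one[OF assms, of n] assms by auto
  show "0 \<le> damping a q N k" unfolding damping_def using q a by (intro prod_nonneg) auto
  show "damping a q N k \<le> 1"
    unfolding damping_def using q a by (intro prod_le_1 conjI mult_nonneg_nonneg mult_le_one) auto
qed

lemma damping_tendsto:
  assumes "0 < q" "q < 1"
  shows "(\<lambda>N. damping a q N k) \<longlonglongrightarrow> 1"
proof -
  have "(\<lambda>n. q ^ n) \<longlonglongrightarrow> 0" using assms by (intro LIMSEQ_power_zero) auto
  hence "(\<lambda>N. q ^ (N - j)) \<longlonglongrightarrow> 0" "(\<lambda>N. q ^ (N + j)) \<longlonglongrightarrow> 0" for j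
    using filterlim_compose[OF _ filterlim_minus_const_nat_at_top[of j]] LIMSEQ_ignore_initial_segment
    by blast+
  hence "(\<lambda>N. damping a q N k) \<longlonglongrightarrow> (\<Prod>j<k. (1 - 0) * (1 - a * 0))"
    unfolding damping_def by (intro tendsto_prod tendsto_mult tendsto_diff tendsto_const)
  thus ?thesis by simp
qed

text \<open>
  The ratio of consecutive coefficients is of order \<open>q ^ k\<close>. The factor \<open>k + 1\<close> is what
  the argument against equality in the Euler--Rayleigh inequalities consumes.
\<close>

lemma hahn_exton_coeff_ratio_tendsto:
  fixes a q :: real and m :: nat
  assumes "0 < q" "q < 1" "0 < a" "a < 1"
  defines "g \<equiv> \<lambda>k. real (Suc k) ^ m * hahn_exton_coeff a q k"
  shows "(\<lambda>k. real (Suc k) * (g (Suc k) / g k)) \<longlonglongrightarrow> 0"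
proof -
  have "real (Suc k) * (g (Suc k) / g k) =
      (real (Suc (Suc k)) / real (Suc k)) ^ m * (real (Suc k) * q ^ Suc k) *
      (- 1 / ((1 - q ^ Suc k) * (1 - a * q ^ k)))" for k
    using hahn_exton_coeff_nonzero[OF assms(1-4), of k]
    by (simp add: g_def hahn_exton_coeff_Suc power_divide mult_ac del: power_Suc of_nat_Suc)
  moreover have "(\<lambda>k. (real (Suc (Suc k)) / real (Suc k)) ^ m * (real (Suc k) * q ^ Suc k) *
      (- 1 / ((1 - q ^ Suc k) * (1 - a * q ^ k)))) \<longlonglongrightarrow> 1 ^ m * 0 * (- 1 / ((1 - 0) * (1 - a * 0)))"
  proof (intro tendsto_mult tendsto_power tendsto_divide tendsto_diff tendsto_const)
    show "(\<lambda>k. real (Suc (Suc k)) / real (Suc k)) \<longlonglongrightarrow> 1"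
      using LIMSEQ_Suc[OF LIMSEQ_Suc_n_over_n] by simp
    show "(\<lambda>k. real (Suc k) * q ^ Suc k) \<longlonglongrightarrow> 0"
      using LIMSEQ_Suc[OF powser_times_n_limit_0[of q]] assms by simp
    have "(\<lambda>n. q ^ n) \<longlonglongrightarrow> 0" using assms by (intro LIMSEQ_power_zero) auto
    thus "(\<lambda>n. q ^ Suc n) \<longlonglongrightarrow> 0" "(\<lambda>n. q ^ n) \<longlonglongrightarrow> 0" by (auto intro: LIMSEQ_Suc simp del: power_Suc)
  qed simp
  ultimately show ?thesis by simp
qed

section \<open>Everywhere convergent power series with real coefficients\<close>

text \<open>
  One polymorphic function serves the real axis, where zeros are located, and the complex plane, where
  convexity is tested.
\<close>

definition pseries :: "(nat \<Rightarrow> real) \<Rightarrow> 'a \<Rightarrow> 'a::{real_normed_field, banach}" where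
  "pseries g z = (\<Sum>k. of_real (g k) * z ^ k)"

lemma summable_of_ratio_tendsto_zero:
  fixes g :: "nat \<Rightarrow> real"
  assumes nz: "\<And>k. g k \<noteq> 0" and ratio: "(\<lambda>k. real (Suc k) * (g (Suc k) / g k)) \<longlonglongrightarrow> 0"
    and R: "0 \<le> R"
  shows "summable (\<lambda>k. \<bar>g k\<bar> * R ^ k)"
proof -
  have "(\<lambda>k. \<bar>real (Suc k) * (g (Suc k) / g k)\<bar>) \<longlonglongrightarrow> 0"
    using tendsto_rabs[OF ratio] by simp
  hence "eventually (\<lambda>k. \<bar>real (Suc k) * (g (Suc k) / g k)\<bar> < 1 / (2 * (R + 1))) sequentially"
    using R by (intro order_tendstoD(2)) auto
  then obtain K where K: "\<And>k. k \<ge> K \<Longrightarrow> \<bar>real (Suc k) * (g (Suc k) / g k)\<bar> < 1 / (2 * (R + 1))"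
    unfolding eventually_sequentially by blast
  show ?thesis
  proof (rule summable_ratio_test[of "1 / 2" K])
    fix k assume "k \<ge> K"
    have "1 * \<bar>g (Suc k) / g k\<bar> \<le> real (Suc k) * \<bar>g (Suc k) / g k\<bar>"
      by (intro mult_right_mono) auto
    hence "\<bar>g (Suc k) / g k\<bar> \<le> 1 / (2 * (R + 1))"
      using K[OF \<open>k \<ge> K\<close>] by (simp add: abs_mult del: of_nat_Suc)
    hence "\<bar>g (Suc k) / g k\<bar> * R \<le> 1 / (2 * (R + 1)) * R"
      using R by (intro mult_right_mono) auto
    also have "\<dots> \<le> 1 / 2" using R by (simp add: field_simps)
    finally have *: "\<bar>g (Suc k) / g k\<bar> * R \<le> 1 / 2" .
    have "\<bar>g (Suc k)\<bar> * R ^ Suc k = (\<bar>g (Suc k) / g k\<bar> * R) * (\<bar>g k\<bar> * R ^ k)"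
      using nz[of k] by (simp add: abs_divide)
    also have "\<dots> \<le> 1 / 2 * (\<bar>g k\<bar> * R ^ k)"
      using * R by (intro mult_right_mono) auto
    finally show "norm (\<bar>g (Suc k)\<bar> * R ^ Suc k) \<le> 1 / 2 * norm (\<bar>g k\<bar> * R ^ k)"
      using R by (simp add: abs_mult)
  qed simp
qed

context
  fixes g :: "nat \<Rightarrow> real"
  assumes summ: "\<And>R. 0 \<le> R \<Longrightarrow> summable (\<lambda>k. \<bar>g k\<bar> * R ^ k)"
begin

lemma pseries_summable: "summable (\<lambda>k. of_real (g k) * (z::'a::{real_normed_field, banach}) ^ k)"
proof (rule summable_norm_cancel)
  show "summable (\<lambda>k. norm (of_real (g k) * z ^ k))"
    using summ[of "norm z"] by (simp add: norm_mult norm_power)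
qed

lemma pseries_has_field_derivative:
  "(pseries g has_field_derivative pseries (diffs g) z) (at (z::'a::{real_normed_field, banach}))"
proof -
  have "((\<lambda>z. \<Sum>k. of_real (g k) * z ^ k) has_field_derivative
      (\<Sum>k. diffs (\<lambda>k. of_real (g k)) k * z ^ k)) (at z)"
    by (rule termdiffs_strong_converges_everywhere) (rule pseries_summable)
  moreover have "diffs (\<lambda>k. of_real (g k)) k = (of_real (diffs g k) :: 'a)" for k
    by (simp add: diffs_def)
  ultimately show ?thesis unfolding pseries_def[abs_def] by simp
qed

lemma isCont_pseries: "isCont (pseries g) (z::'a::{real_normed_field, banach})"
  using pseries_has_field_derivative by (rule DERIV_isCont)

lemma mult_pseries_has_field_derivative:
  "((\<lambda>z. z * pseries g z) has_field_derivative pseries (\<lambda>k. real (Suc k) * g k) z)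
     (at (z::'a::{real_normed_field, banach}))"
proof -
  define c where "c k = (case k of 0 \<Rightarrow> 0 | Suc j \<Rightarrow> (of_real (g j) :: 'a))" for k
  have S: "(\<lambda>k. c k * z ^ k) sums (z * pseries g z)" for z
  proof -
    have "(\<lambda>k. z * (of_real (g k) * z ^ k)) sums (z * pseries g z)"
      unfolding pseries_def by (intro sums_mult summable_sums pseries_summable)
    hence "(\<lambda>k. c (Suc k) * z ^ Suc k) sums (z * pseries g z)"
      by (simp add: c_def mult_ac)
    thus ?thesis by (subst (asm) sums_Suc_iff) (simp add: c_def)
  qed
  have "((\<lambda>z. \<Sum>k. c k * z ^ k) has_field_derivative (\<Sum>k. diffs c k * z ^ k)) (at z)"
    using S by (intro termdiffs_strong_converges_everywhere) (auto simp: sums_iff)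
  moreover have "(\<lambda>z. \<Sum>k. c k * z ^ k) = (\<lambda>z. z * pseries g z)"
    using S by (auto simp: sums_iff)
  moreover have "diffs c k = of_real (real (Suc k) * g k)" for k
    by (simp add: diffs_def c_def)
  ultimately show ?thesis by (simp add: pseries_def)
qed

lemma pseries_of_real: "pseries g (of_real t :: 'a::{real_normed_field, banach}) = of_real (pseries g t)"
proof -
  have "of_real (\<Sum>k. g k * t ^ k) = (\<Sum>k. of_real (g k * t ^ k) :: 'a)"
    using pseries_summable[of t] by (intro suminf_of_real) simp
  thus ?thesis by (simp add: pseries_def)
qed

lemma pseries_0: "pseries g (0::'a::{real_normed_field, banach}) = of_real (g 0)"
proof -
  have "(\<lambda>k. of_real (g k) * (0::'a) ^ k) sums (\<Sum>k\<in>{0}. of_real (g k) * (0::'a) ^ k)"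
    by (rule sums_finite) auto
  thus ?thesis by (simp add: pseries_def sums_iff)
qed

end

section \<open>Limits of polynomials with positive zeros\<close>

text \<open>
  Logarithmic differentiation as formal power series: \<open>- F' / F\<close> is the generating function of the power
  sums, because a factor \<open>1 - x * z\<close> contributes \<open>x / (1 - x * z)\<close>.
\<close>

lemma newton_identity_root_prod:
  "real (Suc k) * coeff (root_prod x n) (Suc k) =
     - (\<Sum>j\<le>k. coeff (root_prod x n) (k - j) * (\<Sum>i<n. x i ^ Suc j))"
proof -
  define F where "F n = fps_of_poly (root_prod x n :: real poly)" for n
  define P where "P n = Abs_fps (\<lambda>j. \<Sum>i<n. x i ^ Suc j)" for n
  have F_Suc: "F (Suc n) = F n * (1 - fps_const (x n) * fps_X)" for n
  proof -
    have "fps_of_poly [:1, - x n:] = 1 - fps_const (x n) * fps_X"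
      by (simp add: fps_of_poly_pCons fps_const_neg[symmetric] del: fps_const_neg)
    thus ?thesis by (simp add: F_def root_prod_Suc fps_of_poly_mult del: mult_pCons_right)
  qed
  have "fps_deriv (F n) = - (P n * F n)"
  proof (induction n)
    case 0
    have "F 0 = 1" "P 0 = 0" by (simp_all add: F_def P_def root_prod_def fps_eq_iff)
    thus ?case by simp
  next
    case (Suc n)
    define E where "E = Abs_fps (\<lambda>j. x n ^ Suc j)"
    have E: "E * (1 - fps_const (x n) * fps_X) = fps_const (x n)"
    proof -
      have "E * (1 - fps_const (x n) * fps_X) = E - fps_const (x n) * (E * fps_X)"
        by (simp only: right_diff_distrib mult_1_right mult.left_commute)
      also have "\<dots> = fps_const (x n)"
        by (rule fps_ext) (simp add: E_def fps_X_mult_right_nth power_eq_if)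
      finally show ?thesis .
    qed
    have P: "P (Suc n) = P n + E"
      by (simp add: P_def E_def fps_eq_iff)
    have "fps_deriv (F (Suc n)) = fps_deriv (F n) * (1 - fps_const (x n) * fps_X) - F n * fps_const (x n)"
      unfolding F_Suc by (simp add: algebra_simps)
    also have "\<dots> = - (P n * F n * (1 - fps_const (x n) * fps_X) +
        F n * (E * (1 - fps_const (x n) * fps_X)))"
      unfolding Suc.IH E by (simp add: algebra_simps)
    also have "\<dots> = - (P (Suc n) * F (Suc n))"
      unfolding P F_Suc by (simp add: algebra_simps)
    finally show ?case .
  qed
  hence "fps_nth (fps_deriv (F n)) k = fps_nth (- (P n * F n)) k" by simp
  moreover have "fps_nth (P n * F n) k =
      (\<Sum>j\<le>k. coeff (root_prod x n) (k - j) * (\<Sum>i<n. x i ^ Suc j))"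
    unfolding fps_mult_nth atLeast0AtMost F_def P_def by (simp add: mult.commute del: power_Suc)
  ultimately show ?thesis
    by (simp add: F_def)
qed

text \<open>
  The series \<open>g\<close> is the limit of products \<open>\<Prod>i<N. 1 - x N i * z\<close> whose coefficients are \<open>g k\<close> damped by
  factors in \<open>[0, 1]\<close>. The damping makes \<open>g\<close> itself a dominating series, so that every passage to the
  limit is an instance of Tannery's theorem. The ratio condition expresses more than convergence
  everywhere: it excludes factors \<open>exp (- c z)\<close>, which locally uniform limits of such products
  may in general have.
\<close>

locale real_rooted_limit =
  fixes g :: "nat \<Rightarrow> real" and d :: "nat \<Rightarrow> nat \<Rightarrow> real" and x :: "nat \<Rightarrow> nat \<Rightarrow> real"
  assumes g_0: "g 0 = 1"
    and g_nonzero: "g k \<noteq> 0"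
    and g_ratio: "(\<lambda>k. real (Suc k) * (g (Suc k) / g k)) \<longlonglongrightarrow> 0"
    and d_nonneg: "0 \<le> d N k"
    and d_le_one: "d N k \<le> 1"
    and d_tendsto: "(\<lambda>N. d N k) \<longlonglongrightarrow> 1"
    and x_pos: "i < N \<Longrightarrow> 0 < x N i"
    and coeff_approx: "coeff (root_prod (x N) N) k = d N k * g k"
begin

lemma g_summable: "0 \<le> R \<Longrightarrow> summable (\<lambda>k. \<bar>g k\<bar> * R ^ k)"
  using summable_of_ratio_tendsto_zero[OF g_nonzero g_ratio] .

lemma damped_series_tendsto:
  fixes z :: "'a::{real_normed_field, banach}"
  assumes "summable (\<lambda>k. \<bar>c k\<bar> * norm z ^ k)"
  shows "(\<lambda>N. \<Sum>k. of_real (d N k * c k) * z ^ k) \<longlonglongrightarrow> pseries c z"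
  unfolding pseries_def
proof (rule conjunct2[OF conjunct2[OF tannerys_theorem[where M = "\<lambda>k. \<bar>c k\<bar> * norm z ^ k"]]])
  have "(\<lambda>N. of_real (d N k * c k) * z ^ k) \<longlonglongrightarrow> of_real (1 * c k) * z ^ k" for k
    by (intro tendsto_intros d_tendsto)
  thus "(\<lambda>N. of_real (d N k * c k) * z ^ k) \<longlonglongrightarrow> of_real (c k) * z ^ k" for k
    by simp
  show "\<forall>\<^sub>F (k, N) in sequentially \<times>\<^sub>F sequentially.
      norm (of_real (d N k * c k) * z ^ k) \<le> \<bar>c k\<bar> * norm z ^ k"
    using d_nonneg d_le_one
    by (intro always_eventually)
       (auto simp: norm_mult norm_power abs_mult intro!: mult_right_mono mult_left_le_one_le)
qed (use assms in auto)

lemma approx_tendsto: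
  "(\<lambda>N. \<Prod>i<N. 1 - of_real (x N i) * z) \<longlonglongrightarrow> pseries g (z::'a::{real_normed_field, banach})"
proof -
  have "(\<Prod>i<N. 1 - of_real (x N i) * z) = (\<Sum>k. of_real (d N k * g k) * z ^ k)" for N
    using root_prod_sums[of "x N" N z] unfolding coeff_approx by (simp add: sums_iff)
  thus ?thesis using damped_series_tendsto[of g z] g_summable[of "norm z"] by simp
qed

text \<open>
  Convergence is uniform on \<open>[0, R]\<close>, with error at most \<open>\<Delta> N\<close> below, while the limit stays away from
  \<open>0\<close> there.
\<close>

lemma eventually_no_approx_zero:
  assumes "0 \<le> R" and pos: "\<And>t. 0 \<le> t \<Longrightarrow> t \<le> R \<Longrightarrow> 0 < pseries g t"
  shows "eventually (\<lambda>N. \<forall>i<N. x N i * R < 1) sequentially"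
proof -
  define \<Delta> where "\<Delta> N = (\<Sum>k. (1 - d N k) * (\<bar>g k\<bar> * R ^ k))" for N
  have sumR: "summable (\<lambda>k. \<bar>g k\<bar> * R ^ k)" using assms(1) by (rule g_summable)
  have sum\<Delta>: "summable (\<lambda>k. (1 - d N k) * (\<bar>g k\<bar> * R ^ k))" for N
    using assms(1) d_nonneg d_le_one
    by (intro summable_comparison_test'[OF sumR, of 0])
       (auto simp: abs_mult intro!: mult_left_le_one_le)
  have "\<Delta> N = (\<Sum>k. \<bar>g k\<bar> * R ^ k) - (\<Sum>k. of_real (d N k * \<bar>g k\<bar>) * R ^ k)" for N
  proof -
    have "summable (\<lambda>k. d N k * (\<bar>g k\<bar> * R ^ k))"
      using summable_diff[OF sumR sum\<Delta>[of N]] by (simp add: algebra_simps)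
    from suminf_diff[OF sumR this] show ?thesis
      unfolding \<Delta>_def by (simp add: algebra_simps)
  qed
  moreover have "(\<lambda>N. (\<Sum>k. \<bar>g k\<bar> * R ^ k) - (\<Sum>k. of_real (d N k * \<bar>g k\<bar>) * R ^ k)) \<longlonglongrightarrow>
      (\<Sum>k. \<bar>g k\<bar> * R ^ k) - pseries (\<lambda>k. \<bar>g k\<bar>) R"
    using assms(1) sumR by (intro tendsto_intros damped_series_tendsto) auto
  ultimately have "(\<lambda>N. \<Delta> N) \<longlonglongrightarrow> (\<Sum>k. \<bar>g k\<bar> * R ^ k) - pseries (\<lambda>k. \<bar>g k\<bar>) R"
    by (simp only:)
  hence \<Delta>_lim: "\<Delta> \<longlonglongrightarrow> 0" by (simp add: pseries_def)
  have "continuous_on {0..R} (pseries g)"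
    by (intro continuous_at_imp_continuous_on ballI isCont_pseries g_summable)
  then obtain t0 where t0: "t0 \<in> {0..R}" "\<And>t. t \<in> {0..R} \<Longrightarrow> pseries g t0 \<le> pseries g t"
    using continuous_attains_inf[of "{0..R}" "pseries g"] assms(1) by auto
  have "0 < pseries g t0" using t0(1) pos by auto
  with \<Delta>_lim have "eventually (\<lambda>N. \<Delta> N < pseries g t0) sequentially"
    by (rule order_tendstoD(2))
  moreover have "x N i * R < 1" if N: "\<Delta> N < pseries g t0" and i: "i < N" for N i
  proof (rule ccontr)
    assume ge: "\<not> x N i * R < 1"
    define t where "t = 1 / x N i"
    have t: "0 \<le> t" "t \<le> R" using x_pos[OF i] ge by (auto simp: t_def field_simps)
    have "(\<Prod>i<N. 1 - x N i * t) = 0"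
      using i x_pos[OF i] by (intro prod_zero bexI[of _ i]) (auto simp: t_def)
    hence s0: "(\<lambda>k. (d N k * g k) * t ^ k) sums 0"
      using root_prod_sums[of "x N" N t] unfolding coeff_approx by (simp del: prod_zero_iff)
    have s1: "(\<lambda>k. g k * t ^ k) sums pseries g t"
      using summable_sums[OF pseries_summable[OF g_summable, of t]] by (simp add: pseries_def)
    have "(\<lambda>k. g k * t ^ k - (d N k * g k) * t ^ k) sums (pseries g t - 0)"
      by (intro sums_diff s1 s0)
    hence "(\<lambda>k. (1 - d N k) * g k * t ^ k) sums pseries g t"
      by (simp add: algebra_simps)
    moreover have "(\<lambda>k. (1 - d N k) * (\<bar>g k\<bar> * R ^ k)) sums \<Delta> N"
      unfolding \<Delta>_def by (intro summable_sums sum\<Delta>)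
    moreover have "(1 - d N k) * g k * t ^ k \<le> (1 - d N k) * (\<bar>g k\<bar> * R ^ k)" for k
      unfolding mult.assoc using d_le_one t
      by (intro mult_left_mono mult_mono power_mono) auto
    ultimately have "pseries g t \<le> \<Delta> N" by (rule sums_le[rotated])
    thus False using N t0(2)[of t] t by auto
  qed
  ultimately show ?thesis by (auto elim: eventually_mono)
qed

text \<open>
  The index is shifted: \<open>power_sum k\<close> is the limit of the power sums of exponent \<open>k + 1\<close>. It is
  taken as a limit and not as a sum over the zeros of the limit function: for \<open>k = 0\<close>, many reciprocals
  tending to \<open>0\<close> can keep a positive total, so that identifying the two would need a separate argument.
\<close>

definition power_sum :: "nat \<Rightarrow> real" where
  "power_sum k = lim (\<lambda>N. \<Sum>i<N. x N i ^ Suc k)"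

lemma coeff_approx_tendsto: "(\<lambda>N. coeff (root_prod (x N) N) k) \<longlonglongrightarrow> g k"
proof -
  have "(\<lambda>N. d N k * g k) \<longlonglongrightarrow> 1 * g k" by (intro tendsto_intros d_tendsto)
  thus ?thesis by (simp add: coeff_approx)
qed

text \<open>
  Newton's identities determine the power sums recursively from coefficients that converge.
\<close>

lemma power_sum_tendsto: "(\<lambda>N. \<Sum>i<N. x N i ^ Suc k) \<longlonglongrightarrow> power_sum k"
proof (induction k rule: less_induct)
  case (less k)
  have "(\<Sum>i<N. x N i ^ Suc k) = - (real (Suc k) * coeff (root_prod (x N) N) (Suc k)) -
      (\<Sum>j<k. coeff (root_prod (x N) N) (k - j) * (\<Sum>i<N. x N i ^ Suc j))" for N
  proof -
    have "coeff (root_prod (x N) N :: real poly) 0 = 1"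
      using poly_root_prod[of "x N" N "0::real"] by (simp add: poly_0_coeff_0)
    moreover have "{..k} = insert k {..<k}" by auto
    ultimately show ?thesis using newton_identity_root_prod[of k "x N" N] by (simp del: of_nat_Suc)
  qed
  moreover have "(\<lambda>N. - (real (Suc k) * coeff (root_prod (x N) N) (Suc k)) -
      (\<Sum>j<k. coeff (root_prod (x N) N) (k - j) * (\<Sum>i<N. x N i ^ Suc j))) \<longlonglongrightarrow>
      - (real (Suc k) * g (Suc k)) - (\<Sum>j<k. g (k - j) * power_sum j)"
    by (intro tendsto_intros coeff_approx_tendsto less.IH) auto
  ultimately have "(\<lambda>N. \<Sum>i<N. x N i ^ Suc k) \<longlonglongrightarrow>
      - (real (Suc k) * g (Suc k)) - (\<Sum>j<k. g (k - j) * power_sum j)" by simp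
  thus ?case unfolding power_sum_def using limI by fastforce
qed

lemma newton_identity: "real (Suc k) * g (Suc k) = - (\<Sum>j\<le>k. g (k - j) * power_sum j)"
proof (rule LIMSEQ_unique)
  show "(\<lambda>N. real (Suc k) * coeff (root_prod (x N) N) (Suc k)) \<longlonglongrightarrow> real (Suc k) * g (Suc k)"
    by (intro tendsto_intros coeff_approx_tendsto)
  show "(\<lambda>N. real (Suc k) * coeff (root_prod (x N) N) (Suc k)) \<longlonglongrightarrow> - (\<Sum>j\<le>k. g (k - j) * power_sum j)"
    unfolding newton_identity_root_prod by (intro tendsto_intros coeff_approx_tendsto power_sum_tendsto)
qed

lemma power_sum_nonneg: "0 \<le> power_sum k"
proof (rule LIMSEQ_le_const[OF power_sum_tendsto])
  show "\<exists>N. \<forall>n\<ge>N. 0 \<le> (\<Sum>i<n. x n i ^ Suc k)"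
    using less_imp_le[OF x_pos] by (intro exI allI impI sum_nonneg zero_le_power) auto
qed

text \<open>
  Compare termwise for the approximants, using \<open>x N i * R < 1\<close>. The first inequality bounds the first zero
  from above. The second one sums \<open>x ^ (k + 1) * (1 - R * x)^2 \<ge> 0\<close> and makes
  equality in the first one pass on to the next index.
\<close>

lemma power_sum_bounds_of_positive:
  assumes R: "0 \<le> R" and pos: "\<And>t. 0 \<le> t \<Longrightarrow> t \<le> R \<Longrightarrow> 0 < pseries g t"
  shows "R * power_sum (Suc k) \<le> power_sum k"
    and "R * (power_sum (Suc k) - R * power_sum (Suc (Suc k))) \<le> power_sum k - R * power_sum (Suc k)"
proof -
  note ev = eventually_no_approx_zero[OF R pos]
  show "R * power_sum (Suc k) \<le> power_sum k"
  proof (rule tendsto_le[OF _ power_sum_tendsto tendsto_mult[OF tendsto_const power_sum_tendsto]])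
    show "\<forall>\<^sub>F N in sequentially. R * (\<Sum>i<N. x N i ^ Suc (Suc k)) \<le> (\<Sum>i<N. x N i ^ Suc k)"
      using ev
    proof (rule eventually_mono)
      fix N assume N: "\<forall>i<N. x N i * R < 1"
      have "R * x N i ^ Suc (Suc k) \<le> x N i ^ Suc k" if "i < N" for i
      proof -
        have "(x N i * R) * x N i ^ Suc k \<le> 1 * x N i ^ Suc k"
          using N that x_pos[OF that] by (intro mult_right_mono) auto
        thus ?thesis by (simp add: mult_ac)
      qed
      thus "R * (\<Sum>i<N. x N i ^ Suc (Suc k)) \<le> (\<Sum>i<N. x N i ^ Suc k)"
        unfolding sum_distrib_left by (intro sum_mono) auto
    qed
  qed simp
  show "R * (power_sum (Suc k) - R * power_sum (Suc (Suc k))) \<le> power_sum k - R * power_sum (Suc k)"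
  proof (rule tendsto_le)
    show "\<forall>\<^sub>F N in sequentially. R * ((\<Sum>i<N. x N i ^ Suc (Suc k)) - R * (\<Sum>i<N. x N i ^ Suc (Suc (Suc k))))
        \<le> (\<Sum>i<N. x N i ^ Suc k) - R * (\<Sum>i<N. x N i ^ Suc (Suc k))"
      using ev
    proof (rule eventually_mono)
      fix N assume N: "\<forall>i<N. x N i * R < 1"
      have "R * (x N i ^ Suc (Suc k) - R * x N i ^ Suc (Suc (Suc k)))
          \<le> x N i ^ Suc k - R * x N i ^ Suc (Suc k)" if "i < N" for i
      proof -
        have "0 \<le> x N i ^ Suc k * (1 - x N i * R) ^ 2"
          using x_pos[OF that] by (intro mult_nonneg_nonneg) auto
        thus ?thesis by (simp add: power2_eq_square algebra_simps)
      qed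
      thus "R * ((\<Sum>i<N. x N i ^ Suc (Suc k)) - R * (\<Sum>i<N. x N i ^ Suc (Suc (Suc k))))
        \<le> (\<Sum>i<N. x N i ^ Suc k) - R * (\<Sum>i<N. x N i ^ Suc (Suc k))"
        unfolding sum_distrib_left sum_subtractf[symmetric] by (intro sum_mono) auto
    qed
  qed (intro tendsto_intros power_sum_tendsto | simp)+
qed

text \<open>
  If the power sums were geometric from the second on, Newton's identities would collapse to a
  recurrence of order two for \<open>g\<close>, the one belonging to \<open>exp (- c z) (1 - z / \<gamma>) ^ m\<close> with
  \<open>c = P 0 - \<gamma> * P 1\<close>, where \<open>P\<close> stands for \<open>power_sum\<close>. Dividing by \<open>g k\<close> and letting \<open>k\<close> grow, the
  ratio condition first forces \<open>c = 0\<close>; dividing once more, it forces \<open>k + 1\<close> to stay bounded.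
\<close>

lemma power_sum_not_geometric: "\<exists>j\<ge>1. \<gamma> * power_sum (Suc j) \<noteq> power_sum j"
proof (rule ccontr)
  assume "\<not> ?thesis"
  hence geo: "\<gamma> * power_sum (Suc j) = power_sum j" if "1 \<le> j" for j using that by blast
  define \<rho> where "\<rho> k = g (Suc k) / g k" for k
  have \<rho>: "g (Suc k) = \<rho> k * g k" for k using g_nonzero[of k] by (simp add: \<rho>_def)
  have lim1: "(\<lambda>k. real (Suc k) * \<rho> k) \<longlonglongrightarrow> 0" using g_ratio by (simp add: \<rho>_def)
  have lim0: "\<rho> \<longlonglongrightarrow> 0"
  proof (rule Lim_null_comparison[OF _ tendsto_rabs_zero[OF lim1]])
    have "1 * \<bar>\<rho> k\<bar> \<le> real (Suc k) * \<bar>\<rho> k\<bar>" for k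
      by (intro mult_right_mono) auto
    thus "\<forall>\<^sub>F k in sequentially. norm (\<rho> k) \<le> \<bar>real (Suc k) * \<rho> k\<bar>"
      by (intro always_eventually) (simp add: abs_mult del: of_nat_Suc)
  qed
  have rec: "real (Suc k) * \<rho> k - \<gamma> * (real (Suc (Suc k)) * \<rho> (Suc k)) * \<rho> k =
      \<gamma> * power_sum 0 * \<rho> k + (\<gamma> * power_sum 1 - power_sum 0)" for k
  proof -
    have A: "(\<Sum>j\<le>Suc k. g (Suc k - j) * power_sum j) =
        g (Suc k) * power_sum 0 + g k * power_sum 1 + (\<Sum>j<k. g (k - Suc j) * power_sum (Suc (Suc j)))"
      unfolding sum.atMost_Suc_shift lessThan_Suc_atMost[symmetric] by (simp add: sum.lessThan_Suc_shift del: sum.lessThan_Suc)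
    have B: "(\<Sum>j\<le>k. g (k - j) * power_sum j) = g k * power_sum 0 + (\<Sum>j<k. g (k - Suc j) * power_sum (Suc j))"
      unfolding lessThan_Suc_atMost[symmetric] by (simp add: sum.lessThan_Suc_shift del: sum.lessThan_Suc)
    have C: "\<gamma> * (\<Sum>j<k. g (k - Suc j) * power_sum (Suc (Suc j))) = (\<Sum>j<k. g (k - Suc j) * power_sum (Suc j))"
      unfolding sum_distrib_left
      by (intro sum.cong refl) (simp add: geo mult.left_commute[of \<gamma>])
    have "real (Suc k) * g (Suc k) - \<gamma> * (real (Suc (Suc k)) * g (Suc (Suc k))) =
        \<gamma> * power_sum 0 * g (Suc k) + (\<gamma> * power_sum 1 - power_sum 0) * g k"
      using C unfolding newton_identity A B by (simp add: algebra_simps)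
    hence "g k * (real (Suc k) * \<rho> k - \<gamma> * (real (Suc (Suc k)) * \<rho> (Suc k)) * \<rho> k) =
        g k * (\<gamma> * power_sum 0 * \<rho> k + (\<gamma> * power_sum 1 - power_sum 0))"
      unfolding \<rho> by (simp add: algebra_simps)
    thus ?thesis using g_nonzero[of k] by simp
  qed
  have "(\<lambda>k. real (Suc k) * \<rho> k - \<gamma> * (real (Suc (Suc k)) * \<rho> (Suc k)) * \<rho> k) \<longlonglongrightarrow> 0 - \<gamma> * 0 * 0"
    by (intro tendsto_intros lim0 lim1 LIMSEQ_Suc[OF lim1])
  moreover have "(\<lambda>k. \<gamma> * power_sum 0 * \<rho> k + (\<gamma> * power_sum 1 - power_sum 0)) \<longlonglongrightarrow>
      \<gamma> * power_sum 0 * 0 + (\<gamma> * power_sum 1 - power_sum 0)"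
    by (intro tendsto_intros lim0)
  ultimately have zero: "\<gamma> * power_sum 1 - power_sum 0 = 0"
    unfolding rec using LIMSEQ_unique by fastforce
  have rec': "real (Suc k) = \<gamma> * (real (Suc (Suc k)) * \<rho> (Suc k)) + \<gamma> * power_sum 0" for k
  proof -
    have "\<rho> k * real (Suc k) = \<rho> k * (\<gamma> * (real (Suc (Suc k)) * \<rho> (Suc k)) + \<gamma> * power_sum 0)"
      using rec[of k] unfolding zero by (simp add: algebra_simps del: of_nat_Suc)
    moreover have "\<rho> k \<noteq> 0" using g_nonzero by (simp add: \<rho>_def)
    ultimately show ?thesis by (simp del: of_nat_Suc)
  qed
  have "(\<lambda>k. \<gamma> * (real (Suc (Suc k)) * \<rho> (Suc k)) + \<gamma> * power_sum 0) \<longlonglongrightarrow> \<gamma> * 0 + \<gamma> * power_sum 0"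
    by (intro tendsto_intros LIMSEQ_Suc[OF lim1])
  hence "(\<lambda>k. real (Suc k)) \<longlonglongrightarrow> \<gamma> * 0 + \<gamma> * power_sum 0"
    unfolding rec'[symmetric] .
  moreover have "filterlim (\<lambda>k. real (Suc k)) at_top sequentially"
    using filterlim_compose[OF filterlim_real_sequentially filterlim_Suc] .
  ultimately show False
    using filterlim_at_infinity_imp_filterlim_at_top not_tendsto_and_filterlim_at_infinity
      filterlim_at_top_imp_at_infinity sequentially_bot by blast
qed

end

context real_rooted_limit begin

lemma pseries_at_0: "pseries g (0::real) = 1"
  using pseries_0[OF g_summable, where 'a=real] g_0 by simp

lemma isCont_pseries_g: "isCont (pseries g) (t::real)"
  by (rule isCont_pseries[OF g_summable])

lemma pseries_zero_below:
  fixes t :: real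
  assumes "0 \<le> t" "pseries g t \<le> 0"
  shows "\<exists>s>0. s \<le> t \<and> pseries g s = 0"
proof -
  have "\<exists>s\<ge>0. s \<le> t \<and> pseries g s = 0"
    using IVT2[of "pseries g" t 0 0] assms pseries_at_0 isCont_pseries_g by auto
  then obtain s where s: "0 \<le> s" "s \<le> t" "pseries g s = 0" by blast
  moreover have "s \<noteq> 0" using s(3) pseries_at_0 by auto
  ultimately show ?thesis by (intro exI[of _ s]) simp
qed

text \<open>
  Without a zero the first bound of \<open>power_sum_bounds_of_positive\<close> would hold for all \<open>R\<close>, and all power
  sums from the second on would vanish, which is a geometric sequence.
\<close>

lemma exists_pseries_zero: "\<exists>t>0. pseries g t = (0::real)"
proof (rule ccontr)
  assume none: "\<not> ?thesis"
  have pos: "0 < pseries g t" if "0 \<le> t" for t :: real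
    using pseries_zero_below[OF that] none by (metis not_le)
  have "power_sum (Suc k) = 0" for k
  proof (rule ccontr)
    assume "power_sum (Suc k) \<noteq> 0"
    hence "0 < power_sum (Suc k)" using power_sum_nonneg[of "Suc k"] by simp
    moreover have "(power_sum k / power_sum (Suc k) + 1) * power_sum (Suc k) \<le> power_sum k"
      using pos power_sum_nonneg[of k] power_sum_nonneg[of "Suc k"] by (intro power_sum_bounds_of_positive) auto
    ultimately show False by (simp add: distrib_right)
  qed
  hence "1 * power_sum (Suc j) = power_sum j" if "1 \<le> j" for j
    using that by (cases j) auto
  thus False using power_sum_not_geometric[of 1] by blast
qed

lemma exists_first_zero:
  "\<exists>\<gamma>::real. 0 < \<gamma> \<and> pseries g \<gamma> = 0 \<and> (\<forall>t. 0 \<le> t \<longrightarrow> t < \<gamma> \<longrightarrow> 0 < pseries g t)"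
proof -
  define Z where "Z = {t \<in> {0..}. pseries g t = (0::real)}"
  have "closed Z"
    unfolding Z_def
    by (intro continuous_closed_preimage_constant continuous_at_imp_continuous_on ballI
        isCont_pseries_g closed_atLeast)
  moreover have "Z \<noteq> {}" using exists_pseries_zero by (auto simp: Z_def intro: less_imp_le)
  moreover have bdd: "bdd_below Z" by (auto simp: Z_def bdd_below_def)
  ultimately have Inf_Z: "Inf Z \<in> Z" by (intro closed_contains_Inf)
  show ?thesis
  proof (intro exI[of _ "Inf Z"] conjI allI impI)
    show "pseries g (Inf Z) = 0" using Inf_Z by (simp add: Z_def)
    have "Inf Z \<noteq> 0" using Inf_Z pseries_at_0 by (auto simp: Z_def)
    thus "0 < Inf Z" using Inf_Z by (simp add: Z_def)
  next
    fix t :: real assume t: "0 \<le> t" "t < Inf Z"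
    show "0 < pseries g t"
    proof (rule ccontr)
      assume "\<not> 0 < pseries g t"
      then obtain s where "0 < s" "s \<le> t" "pseries g s = 0"
        using pseries_zero_below[of t] t by (metis not_le)
      hence "Inf Z \<le> s" using bdd by (intro cInf_lower) (auto simp: Z_def)
      thus False using t \<open>s \<le> t\<close> by simp
    qed
  qed
qed

lemma exp_le_one_minus:
  fixes s \<theta> :: real
  assumes "0 \<le> s" "s \<le> \<theta>" "\<theta> < 1"
  shows "exp (- (s / (1 - \<theta>))) \<le> 1 - s"
proof -
  have "s / (1 - s) \<le> s / (1 - \<theta>)" using assms by (intro divide_left_mono) auto
  hence "1 / (1 - s) \<le> 1 + s / (1 - \<theta>)" using assms by (simp add: field_simps)
  also have "\<dots> \<le> exp (s / (1 - \<theta>))" by (rule exp_ge_add_one_self)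
  finally show ?thesis using assms by (simp add: exp_minus field_simps)
qed

text \<open>
  Otherwise the power sum eventually keeps all \<open>x N i\<close> below some \<open>u < 1 / \<gamma>\<close>. Then the products at \<open>\<gamma>\<close> have
  a lower bound depending only on the bounded sum of the \<open>x N i\<close>, and their limit cannot be \<open>0\<close>.
\<close>

lemma power_sum_ge_of_zero:
  assumes \<gamma>: "0 < \<gamma>" "pseries g \<gamma> = 0"
  shows "(1 / \<gamma>) ^ Suc k \<le> power_sum k"
proof (rule ccontr)
  assume "\<not> ?thesis"
  hence less: "power_sum k < (1 / \<gamma>) ^ Suc k" by simp
  define s where "s = root (Suc k) (power_sum k)"
  have s: "0 \<le> s" "s ^ Suc k = power_sum k"
    using power_sum_nonneg[of k] by (simp_all add: s_def real_root_pow_pos2 del: power_Suc)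
  have "s < 1 / \<gamma>"
    using less \<gamma> unfolding s(2)[symmetric] by (intro power_less_imp_less_base[of s "Suc k"]) auto
  define u where "u = (s + 1 / \<gamma>) / 2"
  have u: "s < u" "u < 1 / \<gamma>" using \<open>s < 1 / \<gamma>\<close> by (simp_all add: u_def)
  define \<theta> where "\<theta> = u * \<gamma>"
  have \<theta>: "\<theta> < 1" using u \<gamma> by (simp add: \<theta>_def field_simps)
  have "power_sum k < u ^ Suc k"
    unfolding s(2)[symmetric] using u s by (intro power_strict_mono) auto
  with power_sum_tendsto have "eventually (\<lambda>N. (\<Sum>i<N. x N i ^ Suc k) < u ^ Suc k) sequentially"
    by (rule order_tendstoD(2))
  moreover have "exp (- (\<gamma> / (1 - \<theta>) * (\<Sum>i<N. x N i ^ Suc 0))) \<le> (\<Prod>i<N. 1 - of_real (x N i) * \<gamma>)"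
    if N: "(\<Sum>i<N. x N i ^ Suc k) < u ^ Suc k" for N
  proof -
    have "x N i * \<gamma> \<le> \<theta>" if i: "i < N" for i
    proof -
      have "x N i ^ Suc k \<le> (\<Sum>i<N. x N i ^ Suc k)"
        using i x_pos by (intro member_le_sum) (auto intro!: mult_nonneg_nonneg less_imp_le)
      hence "x N i ^ Suc k < u ^ Suc k" using N by simp
      hence "x N i < u" by (rule power_less_imp_less_base) (use u s in linarith)
      thus ?thesis using \<gamma> by (simp add: \<theta>_def)
    qed
    hence "exp (- (x N i * \<gamma> / (1 - \<theta>))) \<le> 1 - x N i * \<gamma>" if "i < N" for i
      using that \<theta> \<gamma> x_pos[OF that] by (intro exp_le_one_minus) auto
    hence "(\<Prod>i<N. exp (- (x N i * \<gamma> / (1 - \<theta>)))) \<le> (\<Prod>i<N. 1 - x N i * \<gamma>)"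
      by (intro prod_mono) auto
    also have "(\<Prod>i<N. exp (- (x N i * \<gamma> / (1 - \<theta>)))) = exp (\<Sum>i<N. - (x N i * \<gamma> / (1 - \<theta>)))"
      by (simp add: exp_sum)
    also have "(\<Sum>i<N. - (x N i * \<gamma> / (1 - \<theta>))) = - (\<gamma> / (1 - \<theta>) * (\<Sum>i<N. x N i ^ Suc 0))"
      by (simp add: sum_negf sum_distrib_left sum_divide_distrib mult.commute)
    finally show ?thesis by simp
  qed
  ultimately have "\<forall>\<^sub>F N in sequentially. exp (- (\<gamma> / (1 - \<theta>) * (\<Sum>i<N. x N i ^ Suc 0)))
      \<le> (\<Prod>i<N. 1 - of_real (x N i) * \<gamma>)"
    by (rule eventually_mono)
  moreover have "(\<lambda>N. exp (- (\<gamma> / (1 - \<theta>) * (\<Sum>i<N. x N i ^ Suc 0))))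
      \<longlonglongrightarrow> exp (- (\<gamma> / (1 - \<theta>) * power_sum 0))"
    by (intro tendsto_intros power_sum_tendsto)
  ultimately have "exp (- (\<gamma> / (1 - \<theta>) * power_sum 0)) \<le> pseries g \<gamma>"
    using approx_tendsto[of \<gamma>] by (intro tendsto_le[OF sequentially_bot])
  moreover have "0 < exp (- (\<gamma> / (1 - \<theta>) * power_sum 0))" by (rule exp_gt_zero)
  ultimately show False using \<gamma>(2) by linarith
qed

text \<open>
  The nonstrict upper bounds come from \<open>power_sum_bounds_of_positive\<close> as \<open>R\<close> tends to \<open>\<gamma>\<close>. Equality at
  one index would propagate to all later ones, contradicting \<open>power_sum_not_geometric\<close>. The strict lower
  bounds follow from the strict upper bounds by descending from exponent \<open>3\<close>, where the nonstrict lower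
  bound suffices.
\<close>

lemma power_sums_first_zero:
  assumes \<gamma>: "0 < \<gamma>" "pseries g \<gamma> = 0" and pos: "\<And>t. 0 \<le> t \<Longrightarrow> t < \<gamma> \<Longrightarrow> 0 < pseries g t"
  shows "1 / \<gamma> < power_sum 0" "(1 / \<gamma>) ^ 2 < power_sum 1" "\<gamma> * power_sum 1 < power_sum 0" "\<gamma> * power_sum 2 < power_sum 1"
proof -
  have ev: "eventually (\<lambda>R. 0 \<le> R \<and> R < \<gamma>) (at_left \<gamma>)"
    using eventually_at_left_real[OF \<gamma>(1)] by (rule eventually_mono) auto
  have le: "\<gamma> * power_sum (Suc k) \<le> power_sum k" for k
  proof (rule tendsto_upperbound)
    show "((\<lambda>R. R * power_sum (Suc k)) \<longlongrightarrow> \<gamma> * power_sum (Suc k)) (at_left \<gamma>)"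
      by (intro tendsto_intros)
    show "\<forall>\<^sub>F R in at_left \<gamma>. R * power_sum (Suc k) \<le> power_sum k"
      using ev by (rule eventually_mono) (auto intro!: power_sum_bounds_of_positive pos)
  qed simp
  have step: "\<gamma> * (power_sum (Suc k) - \<gamma> * power_sum (Suc (Suc k))) \<le> power_sum k - \<gamma> * power_sum (Suc k)" for k
  proof (rule tendsto_le)
    show "((\<lambda>R. R * (power_sum (Suc k) - R * power_sum (Suc (Suc k)))) \<longlongrightarrow>
        \<gamma> * (power_sum (Suc k) - \<gamma> * power_sum (Suc (Suc k)))) (at_left \<gamma>)"
      by (intro tendsto_intros)
    show "((\<lambda>R. power_sum k - R * power_sum (Suc k)) \<longlongrightarrow> power_sum k - \<gamma> * power_sum (Suc k)) (at_left \<gamma>)"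
      by (intro tendsto_intros)
    show "\<forall>\<^sub>F R in at_left \<gamma>. R * (power_sum (Suc k) - R * power_sum (Suc (Suc k))) \<le> power_sum k - R * power_sum (Suc k)"
      using ev by (rule eventually_mono) (auto intro!: power_sum_bounds_of_positive pos)
  qed simp
  have propagate: "\<gamma> * power_sum (Suc (Suc k)) = power_sum (Suc k)" if "\<gamma> * power_sum (Suc k) = power_sum k" for k
  proof -
    have "\<gamma> * (power_sum (Suc k) - \<gamma> * power_sum (Suc (Suc k))) \<le> \<gamma> * 0" using step[of k] that by simp
    hence "power_sum (Suc k) - \<gamma> * power_sum (Suc (Suc k)) \<le> 0" using \<gamma>(1) by (subst (asm) mult_le_cancel_left_pos) auto
    thus ?thesis using le[of "Suc k"] by simp
  qed
  have "\<gamma> * power_sum 2 \<noteq> power_sum 1"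
  proof
    assume eq: "\<gamma> * power_sum 2 = power_sum 1"
    have "\<gamma> * power_sum (Suc j) = power_sum j" if "1 \<le> j" for j
      using that
    proof (induction j rule: dec_induct)
      case base
      show ?case using eq by (simp add: numeral_2_eq_2)
    next
      case (step j)
      thus ?case by (intro propagate)
    qed
    thus False using power_sum_not_geometric[of \<gamma>] by blast
  qed
  thus P21: "\<gamma> * power_sum 2 < power_sum 1" using le[of 1] by (simp add: numeral_2_eq_2)
  hence "\<gamma> * power_sum 1 \<noteq> power_sum 0" using propagate[of 0] by (auto simp: numeral_2_eq_2)
  thus P10: "\<gamma> * power_sum 1 < power_sum 0" using le[of 0] by simp
  have "(1 / \<gamma>) ^ 2 = \<gamma> * (1 / \<gamma>) ^ Suc 2"
    using \<gamma>(1) by (simp add: power2_eq_square power3_eq_cube)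
  also have "\<dots> \<le> \<gamma> * power_sum 2" using \<gamma> power_sum_ge_of_zero[OF \<gamma>, of 2] by (intro mult_left_mono) auto
  finally show sq: "(1 / \<gamma>) ^ 2 < power_sum 1" using P21 by linarith
  have "1 / \<gamma> = \<gamma> * (1 / \<gamma>) ^ 2" using \<gamma>(1) by (simp add: power2_eq_square)
  also have "\<dots> < \<gamma> * power_sum 1" using \<gamma>(1) sq by (intro mult_strict_left_mono)
  finally show "1 / \<gamma> < power_sum 0" using P10 by linarith
qed

lemma power_sums_eq:
  "power_sum 0 = - g 1" "power_sum 1 = (g 1)\<^sup>2 - 2 * g 2" "power_sum 2 = - ((g 1) ^ 3) + 3 * g 1 * g 2 - 3 * g 3"
proof -
  show P0: "power_sum 0 = - g 1"
    using newton_identity[of 0] g_0 by simp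
  show P1: "power_sum 1 = (g 1)\<^sup>2 - 2 * g 2"
    using newton_identity[of 1] g_0 P0 by (simp add: numeral_2_eq_2 power2_eq_square)
  have "{..2::nat} = {0, 1, 2}" by auto
  hence "3 * g 3 = - (g 2 * power_sum 0 + g 1 * power_sum 1 + power_sum 2)"
    using newton_identity[of 2] g_0 by (simp add: numeral_3_eq_3 add_ac)
  thus "power_sum 2 = - ((g 1) ^ 3) + 3 * g 1 * g 2 - 3 * g 3"
    unfolding P0 P1 by (simp add: algebra_simps power2_eq_square power3_eq_cube)
qed

text \<open>
  Termwise \<open>\<bar>1 - x * z\<bar> \<ge> 1 - x * \<bar>z\<bar>\<close> for the approximants.
\<close>

lemma norm_pseries_ge:
  fixes z :: complex
  assumes pos: "\<And>t. 0 \<le> t \<Longrightarrow> t \<le> norm z \<Longrightarrow> 0 < pseries g t"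
  shows "pseries g (norm z) \<le> norm (pseries g z)"
proof (rule tendsto_le)
  show "(\<lambda>N. \<Prod>i<N. 1 - of_real (x N i) * norm z) \<longlonglongrightarrow> pseries g (norm z)"
    by (rule approx_tendsto)
  show "(\<lambda>N. norm (\<Prod>i<N. 1 - of_real (x N i) * z)) \<longlonglongrightarrow> norm (pseries g z)"
    by (intro tendsto_norm approx_tendsto)
  have "\<forall>\<^sub>F N in sequentially. \<forall>i<N. x N i * norm z < 1"
    using pos by (intro eventually_no_approx_zero) auto
  thus "\<forall>\<^sub>F N in sequentially. (\<Prod>i<N. 1 - of_real (x N i) * norm z)
      \<le> norm (\<Prod>i<N. 1 - of_real (x N i) * z)"
  proof (rule eventually_mono)
    fix N assume N: "\<forall>i<N. x N i * norm z < 1"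
    have "1 - x N i * norm z \<le> norm (1 - of_real (x N i) * z)" if "i < N" for i
      using norm_triangle_ineq2[of 1 "of_real (x N i) * z"] x_pos[OF that]
      by (simp add: norm_mult)
    thus "(\<Prod>i<N. 1 - of_real (x N i) * norm z) \<le> norm (\<Prod>i<N. 1 - of_real (x N i) * z)"
      unfolding prod_norm[symmetric] using N by (intro prod_mono) (auto intro: less_imp_le)
  qed
qed simp

end

lemma poly_pderiv_root_prod:
  fixes z :: "'a::real_normed_field"
  assumes "\<And>i. i < n \<Longrightarrow> 1 - of_real (x i) * z \<noteq> 0"
  shows "poly (pderiv (root_prod x n)) z =
    - poly (root_prod x n) z * (\<Sum>i<n. of_real (x i) / (1 - of_real (x i) * z))"
  using assms
proof (induction n)
  case 0
  thus ?case by (simp add: root_prod_def)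
next
  case (Suc n)
  have nz: "1 - of_real (x n) * z \<noteq> 0" using Suc.prems by simp
  have "poly (pderiv (root_prod x (Suc n))) z =
      poly (pderiv (root_prod x n)) z * (1 - of_real (x n) * z) - of_real (x n) * poly (root_prod x n) z"
    unfolding root_prod_Suc pderiv_mult
    by (simp add: pderiv_pCons algebra_simps del: mult_pCons_right)
  also have "\<dots> = - (poly (root_prod x n) z * (1 - of_real (x n) * z)) *
      ((\<Sum>i<n. of_real (x i) / (1 - of_real (x i) * z)) + of_real (x n) / (1 - of_real (x n) * z))"
    using nz Suc by (simp add: field_simps)
  finally show ?case by (simp add: poly_root_prod)
qed

text \<open>
  The factor \<open>k + 1\<close> turns \<open>p(z)\<close> into \<open>(z p(z))' = p(z) * (1 + z p'(z) / p(z))\<close>.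
\<close>

lemma root_prod_weighted_sums:
  fixes z :: "'a::real_normed_field"
  assumes "\<And>i. i < n \<Longrightarrow> 1 - of_real (x i) * z \<noteq> 0"
  shows "(\<lambda>k. of_real (real (Suc k) * coeff (root_prod x n) k) * z ^ k) sums
    ((\<Prod>i<n. 1 - of_real (x i) * z) * (1 - (\<Sum>i<n. of_real (x i) * z / (1 - of_real (x i) * z))))"
proof -
  define p :: "'a poly" where "p = pderiv (pCons 0 (root_prod x n))"
  have coeff_p: "coeff p k = of_real (real (Suc k) * coeff (root_prod x n) k)" for k
    unfolding p_def coeff_pderiv coeff_pCons_Suc of_real_mult coeff_root_prod_of_real[where 'a='a]
    by simp
  have "(\<lambda>k. coeff p k * z ^ k) sums (\<Sum>k\<le>degree p. coeff p k * z ^ k)"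
    by (rule sums_finite) (auto simp: coeff_eq_0)
  moreover have "poly p z = poly (root_prod x n) z + z * poly (pderiv (root_prod x n)) z"
    by (simp add: p_def pderiv_pCons)
  moreover have "\<dots> = (\<Prod>i<n. 1 - of_real (x i) * z) * (1 - (\<Sum>i<n. of_real (x i) * z / (1 - of_real (x i) * z)))"
  proof -
    have "poly (pderiv (root_prod x n)) z =
        - poly (root_prod x n) z * (\<Sum>i<n. of_real (x i) / (1 - of_real (x i) * z))"
      using assms by (rule poly_pderiv_root_prod)
    moreover have "(\<Sum>i<n. of_real (x i) * z / (1 - of_real (x i) * z)) =
        z * (\<Sum>i<n. of_real (x i) / (1 - of_real (x i) * z))"
      by (simp add: sum_distrib_left mult.commute)
    ultimately show ?thesis
      unfolding poly_root_prod by (simp only: right_diff_distrib mult_1_right)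
        (simp only: mult_minus_left mult_minus_right mult_ac diff_conv_add_uminus)
  qed
  ultimately show ?thesis
    unfolding coeff_p poly_altdef by simp
qed

lemma Re_divide_one_minus_le:
  fixes w :: complex
  assumes "norm w < 1"
  shows "Re (w / (1 - w)) \<le> norm w / (1 - norm w)"
proof -
  have "Re (w / (1 - w)) \<le> norm (w / (1 - w))" by (rule complex_Re_le_cmod)
  also have "\<dots> = norm w / norm (1 - w)" by (rule norm_divide)
  also have "\<dots> \<le> norm w / (1 - norm w)"
  proof (rule divide_left_mono)
    show le: "1 - norm w \<le> norm (1 - w)" using norm_triangle_ineq2[of 1 w] by simp
    show "0 < norm (1 - w) * (1 - norm w)" using le assms by (intro mult_pos_pos) linarith+
  qed simp
  finally show ?thesis .
qed

context real_rooted_limit begin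

text \<open>
  The minimum principle behind the radius of convexity: with \<open>g\<close> the coefficients of \<open>h'\<close>, the quotient is
  \<open>1 + z h'' / h'\<close>, and its real part on a circle is smallest on the positive axis.
\<close>

lemma Re_weighted_quotient_ge:
  fixes z :: complex
  assumes pos: "\<And>t. 0 \<le> t \<Longrightarrow> t \<le> norm z \<Longrightarrow> 0 < pseries g t"
    and summ: "\<And>R. 0 \<le> R \<Longrightarrow> summable (\<lambda>k. \<bar>real (Suc k) * g k\<bar> * R ^ k)"
  shows "pseries (\<lambda>k. real (Suc k) * g k) (norm z) / pseries g (norm z)
    \<le> Re (pseries (\<lambda>k. real (Suc k) * g k) z / pseries g z)"
proof (rule tendsto_le)
  let ?c = "\<lambda>k. real (Suc k) * g k"
  let ?G = "\<lambda>N (z::complex). \<Sum>k. of_real (d N k * ?c k) * z ^ k"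
  let ?GR = "\<lambda>N t. \<Sum>k. of_real (d N k * ?c k) * t ^ k"
  let ?H = "\<lambda>N (z::complex). \<Prod>i<N. 1 - of_real (x N i) * z"
  let ?HR = "\<lambda>N (t::real). \<Prod>i<N. 1 - of_real (x N i) * t"
  have posr: "0 < pseries g (norm z)" using pos by simp
  have "pseries g (norm z) \<le> norm (pseries g z)" using pos by (rule norm_pseries_ge)
  hence nz: "pseries g z \<noteq> 0" using posr by auto
  show "(\<lambda>N. ?GR N (norm z) / ?HR N (norm z)) \<longlonglongrightarrow> pseries ?c (norm z) / pseries g (norm z)"
    using posr summ[of "norm z"] by (intro tendsto_divide damped_series_tendsto approx_tendsto) auto
  show "(\<lambda>N. Re (?G N z / ?H N z)) \<longlonglongrightarrow> Re (pseries ?c z / pseries g z)"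
    using nz summ[of "norm z"]
    by (intro tendsto_Re tendsto_divide damped_series_tendsto approx_tendsto) auto
  have "\<forall>\<^sub>F N in sequentially. \<forall>i<N. x N i * norm z < 1"
    using pos by (intro eventually_no_approx_zero) auto
  thus "\<forall>\<^sub>F N in sequentially. ?GR N (norm z) / ?HR N (norm z) \<le> Re (?G N z / ?H N z)"
  proof (rule eventually_mono)
    fix N assume N: "\<forall>i<N. x N i * norm z < 1"
    have nw: "norm (of_real (x N i) * z) = x N i * norm z" if "i < N" for i
      using x_pos[OF that] by (simp add: norm_mult)
    have nz1: "1 - of_real (x N i) * z \<noteq> 0" if "i < N" for i
      using nw[OF that] N that by (metis eq_iff_diff_eq_0 less_irrefl norm_one)
    have nz2: "1 - of_real (x N i) * norm z \<noteq> 0" if "i < N" for i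
      using N that by auto
    have c: "d N k * ?c k = real (Suc k) * coeff (root_prod (x N) N) k" for k
      by (simp add: coeff_approx)
    have "?G N z = ?H N z * (1 - (\<Sum>i<N. of_real (x N i) * z / (1 - of_real (x N i) * z)))"
      unfolding c by (rule sums_unique[symmetric], rule root_prod_weighted_sums) (rule nz1)
    moreover have "?H N z \<noteq> 0" using nz1 by simp
    ultimately have 1: "?G N z / ?H N z = 1 - (\<Sum>i<N. of_real (x N i) * z / (1 - of_real (x N i) * z))"
      by simp
    have "?GR N (norm z) = ?HR N (norm z) *
        (1 - (\<Sum>i<N. of_real (x N i) * norm z / (1 - of_real (x N i) * norm z)))"
      unfolding c by (rule sums_unique[symmetric], rule root_prod_weighted_sums) (rule nz2)
    moreover have "?HR N (norm z) \<noteq> 0" using nz2 by simp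
    ultimately have 2: "?GR N (norm z) / ?HR N (norm z) =
        1 - (\<Sum>i<N. of_real (x N i) * norm z / (1 - of_real (x N i) * norm z))"
      by simp
    have "(\<Sum>i<N. Re (of_real (x N i) * z / (1 - of_real (x N i) * z)))
        \<le> (\<Sum>i<N. of_real (x N i) * norm z / (1 - of_real (x N i) * norm z))"
    proof (rule sum_mono)
      fix i assume "i \<in> {..<N}"
      hence "norm (of_real (x N i) * z) = x N i * norm z" "x N i * norm z < 1"
        using nw N by auto
      thus "Re (of_real (x N i) * z / (1 - of_real (x N i) * z))
          \<le> of_real (x N i) * norm z / (1 - of_real (x N i) * norm z)"
        using Re_divide_one_minus_le[of "of_real (x N i) * z"] by simp
    qed
    thus "?GR N (norm z) / ?HR N (norm z) \<le> Re (?G N z / ?H N z)"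
      unfolding 1 2 by simp
  qed
qed simp

end

section \<open>Closed forms of the bounds\<close>

text \<open>
  Here \<open>4\<close>, \<open>9\<close>, \<open>16\<close> are the weights \<open>(k + 1)^2\<close>, and \<open>p0\<close>, \<open>p1\<close>, \<open>p2\<close> are the first three power sums by Newton's
  identities.
\<close>

lemma bounds_in_terms_of_power_sums:
  fixes q a :: real
  assumes q: "0 < q" "q < 1" and a: "0 < a" "a < 1"
  defines "b \<equiv> hahn_exton_coeff a q"
  defines "E \<equiv> 8 * (a * q^2) - a * q + q - 8"
  defines "M \<equiv> 5 * q + 11 * (a * q) - 21 * (a * q^2) - 34 * (a * q^3) - 21 * (a * q^4) + 11 * (a * q^5)
    + (a^2 * q^3 + 5 * (a^2 * q^4) + 5 * (a^2 * q^5) + 16 * (a^2 * q^6) + 5 * q^2 + q^3 + 16)"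
  defines "p0 \<equiv> - (4 * b 1)" and "p1 \<equiv> (4 * b 1)\<^sup>2 - 2 * (9 * b 2)"
    and "p2 \<equiv> - ((4 * b 1) ^ 3) + 3 * (4 * b 1) * (9 * b 2) - 3 * (16 * b 3)"
  assumes p1: "0 < p1" and p2: "0 < p2"
  shows "1 / p0 = (1 - q) * (1 - a) / (4 * q)"
    and "p0 / p1 = 2 * (a - 1) * (a * q - 1) * (q^2 - 1) / (q * E)"
    and "1 / p1 = (1 - q)^2 * (1 + q) * (1 - a)^2 * (a * q - 1) / (2 * q^2 * E)"
    and "p1 / p2 = (1 - a) * (1 - a * q^2) * E * ((q - 1) * (q^3 + 2 * q^2 + 2 * q + 1)) / (2 * q * (1 + q) * M)"
proof -
  define A where "A = 1 - q"
  define S where "S = 1 + q"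
  define W where "W = 1 + q + q^2"
  define B where "B = 1 - a"
  define C where "C = 1 - a * q"
  define D where "D = 1 - a * q^2"
  have pos: "0 < A" "0 < S" "0 < W" "0 < B" "0 < C" "0 < D"
    using q a mult_power_less_one[OF q a, of 1] mult_power_less_one[OF q a, of 2]
    by (simp_all add: A_def S_def W_def B_def C_def D_def pos_add_strict)
  have b1: "b 1 = - (q / (A * B))"
    by (simp add: b_def hahn_exton_coeff_Suc A_def B_def) (simp add: hahn_exton_coeff_def qpoch_def)
  have "1 - q^2 = A * S" by (simp add: A_def S_def power2_eq_square algebra_simps)
  hence b2: "b 2 = q^3 / (A^2 * S * B * C)"
    using b1 hahn_exton_coeff_Suc[of a q 1]
    by (simp add: b_def numeral_2_eq_2 C_def) (simp add: power2_eq_square power3_eq_cube mult_ac)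
  have "1 - q^3 = A * W" by (simp add: A_def W_def power2_eq_square power3_eq_cube algebra_simps)
  hence b3: "b 3 = - (q^6 / (A^3 * S * W * B * C * D))"
    using b2 hahn_exton_coeff_Suc[of a q 2]
    by (simp add: b_def eval_nat_numeral D_def mult_ac)
  have E: "16 * S * C - 18 * q * B = - 2 * E"
    by (simp add: S_def C_def B_def E_def power2_eq_square algebra_simps)
  have M: "16 * S * W * C * D - 27 * q * W * B * D + 12 * q^3 * B^2 = M"
    unfolding S_def W_def C_def D_def B_def M_def by algebra
  have p0': "p0 = 4 * q / (A * B)" unfolding p0_def b1 by simp
  have "p1 = q^2 * (16 * S * C - 18 * q * B) / (A^2 * B^2 * S * C)"
    unfolding p1_def b1 b2 using pos by (simp add: field_simps power2_eq_square power3_eq_cube)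
  hence p1': "p1 = - 2 * q^2 * E / (A^2 * B^2 * S * C)" unfolding E by simp
  have "p2 = 4 * q^3 * (16 * S * W * C * D - 27 * q * W * B * D + 12 * q^3 * B^2) / (A^3 * B^3 * S * W * C * D)"
    unfolding p2_def b1 b2 b3 using pos
    by (simp add: field_simps power2_eq_square power3_eq_cube eval_nat_numeral)
  hence p2': "p2 = 4 * q^3 * M / (A^3 * B^3 * S * W * C * D)" unfolding M .
  have nz: "E \<noteq> 0" "M \<noteq> 0" using p1 p2 unfolding p1' p2' by auto
  note nz' = nz pos[THEN less_imp_neq[THEN not_sym]] q(1)[THEN less_imp_neq[THEN not_sym]]
  show "1 / p0 = (1 - q) * (1 - a) / (4 * q)"
    unfolding p0' by (simp add: A_def B_def)
  have "p0 / p1 = - 2 * A * B * S * C / (q * E)"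
    unfolding p0' p1' using nz' by (simp add: field_simps power2_eq_square)
  also have "- 2 * A * B * S * C = 2 * (a - 1) * (a * q - 1) * (q^2 - 1)"
    unfolding A_def B_def S_def C_def by algebra
  finally show "p0 / p1 = 2 * (a - 1) * (a * q - 1) * (q^2 - 1) / (q * E)" .
  have "1 / p1 = - (A^2 * S * B^2 * C) / (2 * q^2 * E)"
    unfolding p1' using nz' by (simp add: field_simps)
  also have "- (A^2 * S * B^2 * C) = (1 - q)^2 * (1 + q) * (1 - a)^2 * (a * q - 1)"
    unfolding A_def B_def S_def C_def by algebra
  finally show "1 / p1 = (1 - q)^2 * (1 + q) * (1 - a)^2 * (a * q - 1) / (2 * q^2 * E)" .
  have "p1 / p2 = - (A * B * W * D * E) / (2 * q * M)"
    unfolding p1' p2' using nz' by (simp add: field_simps power2_eq_square power3_eq_cube)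
  also have "\<dots> = B * D * E * (- A * S * W) / (2 * q * S * M)"
    using nz' by (simp add: field_simps)
  also have "- A * S * W = (q - 1) * (q^3 + 2 * q^2 + 2 * q + 1)"
    unfolding A_def S_def W_def by algebra
  finally show "p1 / p2 = (1 - a) * (1 - a * q^2) * E * ((q - 1) * (q^3 + 2 * q^2 + 2 * q + 1)) / (2 * q * (1 + q) * M)"
    unfolding B_def D_def S_def .
qed

section \<open>The radius of convexity of the Hahn--Exton function\<close>

lemma convexity_quotient:
  fixes f :: "complex \<Rightarrow> complex"
  assumes "deriv f z \<noteq> 0" and diff: "deriv f field_differentiable at z"
    and D: "((\<lambda>z. z * deriv f z) has_field_derivative D) (at z)"
  shows "1 + z * deriv (deriv f) z / deriv f z = D / deriv f z"
proof -
  have "((\<lambda>z. z * deriv f z) has_field_derivative (1 * deriv f z + deriv (deriv f) z * z)) (at z)"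
    using diff by (intro DERIV_mult DERIV_ident) (simp add: DERIV_deriv_iff_field_differentiable)
  hence "D = deriv f z + z * deriv (deriv f) z"
    using DERIV_unique[OF D] by (simp add: mult.commute)
  thus ?thesis using assms(1) by (simp add: field_simps)
qed

lemma radius_of_convexity_eqI:
  assumes \<gamma>: "0 < \<gamma>"
    and inside: "\<And>z. norm z < \<gamma> \<Longrightarrow> deriv f z \<noteq> 0 \<and> 0 < Re (1 + z * deriv (deriv f) z / deriv f z)"
    and boundary: "norm z0 = \<gamma>" "deriv f z0 \<noteq> 0 \<longrightarrow> 1 + z0 * deriv (deriv f) z0 / deriv f z0 = 0"
  shows "radius_of_convexity f = ereal \<gamma>"
  unfolding radius_of_convexity_def
proof (rule antisym)
  show "ereal \<gamma> \<le> (SUP r\<in>{r. 0 < r \<and> (\<forall>z\<in>ball 0 r. deriv f z \<noteq> 0 \<and>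
      Re (1 + z * deriv (deriv f) z / deriv f z) > 0)}. ereal r)"
    using \<gamma> inside by (intro SUP_upper) auto
  show "(SUP r\<in>{r. 0 < r \<and> (\<forall>z\<in>ball 0 r. deriv f z \<noteq> 0 \<and>
      Re (1 + z * deriv (deriv f) z / deriv f z) > 0)}. ereal r) \<le> ereal \<gamma>"
  proof (rule SUP_least, rule ccontr)
    fix r assume r: "r \<in> {r. 0 < r \<and> (\<forall>z\<in>ball 0 r. deriv f z \<noteq> 0 \<and>
      Re (1 + z * deriv (deriv f) z / deriv f z) > 0)}" and "\<not> ereal r \<le> ereal \<gamma>"
    hence "z0 \<in> ball 0 r" using boundary(1) by simp
    hence "deriv f z0 \<noteq> 0" "Re (1 + z0 * deriv (deriv f) z0 / deriv f z0) > 0" using r by blast+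
    thus False using boundary(2) by simp
  qed
qed

definition hahn_exton_const :: "real \<Rightarrow> real \<Rightarrow> real" where
  "hahn_exton_const a q = qpoch_inf a q / qpoch_inf q q"

context
  fixes \<nu> q a :: real
  assumes \<nu>: "\<nu> > -1" and q: "0 < q" "q < 1" and a_def: "a = q powr (\<nu> + 1)"
begin

lemma a_bounds: "0 < a" "a < 1"
  using q \<nu> powr_less_mono'[of q 0 "\<nu> + 1"] by (simp_all add: a_def)

lemma weighted_coeff_summable:
  "0 \<le> R \<Longrightarrow> summable (\<lambda>k. \<bar>real (Suc k) ^ m * hahn_exton_coeff a q k\<bar> * R ^ k)"
  using hahn_exton_coeff_nonzero[OF q a_bounds]
  by (intro summable_of_ratio_tendsto_zero hahn_exton_coeff_ratio_tendsto q a_bounds) auto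

lemma coeff_summable: "0 \<le> R \<Longrightarrow> summable (\<lambda>k. \<bar>hahn_exton_coeff a q k\<bar> * R ^ k)"
  using weighted_coeff_summable[of R 0] by simp

lemma hahn_exton_h_eq: "hahn_exton_h \<nu> q z = z * pseries (hahn_exton_coeff a q) z"
proof -
  have "hahn_exton_h \<nu> q z = (\<Sum>k. z * (of_real (hahn_exton_coeff a q k) * z ^ k))"
    unfolding hahn_exton_h_power_series[OF \<nu> q] hahn_exton_coeff_def a_def by (simp add: mult_ac)
  also have "\<dots> = z * pseries (hahn_exton_coeff a q) z"
    unfolding pseries_def by (intro suminf_mult pseries_summable coeff_summable)
  finally show ?thesis .
qed

lemma const_nonzero: "hahn_exton_const a q \<noteq> 0"
  using q a_bounds by (simp add: hahn_exton_const_def qpoch_inf_nonzero)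

lemma hahn_exton_J_eq:
  assumes t: "0 < (t::real)"
  shows "hahn_exton_J \<nu> q t = hahn_exton_const a q * (t powr (\<nu> - 2) * (t\<^sup>2 * pseries (hahn_exton_coeff a q) (t\<^sup>2)))"
proof -
  have "t powr of_real (2 * real n + \<nu>) = t powr \<nu> * (t\<^sup>2) ^ n" for n
  proof -
    have "t powr (2 * real n) = (t\<^sup>2) ^ n"
      using t by (metis of_nat_mult of_nat_numeral powr_realpow power_mult)
    thus ?thesis by (simp add: powr_add)
  qed
  hence "hahn_exton_J \<nu> q t =
      hahn_exton_const a q * (\<Sum>n. t powr \<nu> * (of_real (hahn_exton_coeff a q n) * (t\<^sup>2) ^ n))"
    unfolding hahn_exton_J_def hahn_exton_const_def a_def[symmetric] hahn_exton_coeff_def by (simp add: mult_ac)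
  also have "(\<Sum>n. t powr \<nu> * (of_real (hahn_exton_coeff a q n) * (t\<^sup>2) ^ n)) =
      t powr \<nu> * pseries (hahn_exton_coeff a q) (t\<^sup>2)"
    unfolding pseries_def by (intro suminf_mult pseries_summable coeff_summable)
  also have "t powr \<nu> = t powr (\<nu> - 2) * t\<^sup>2"
    using t powr_add[of t "\<nu> - 2" 2] by simp
  finally show ?thesis by simp
qed

lemma derivative_coeff_summable: "0 \<le> R \<Longrightarrow> summable (\<lambda>k. \<bar>derivative_coeff a q k\<bar> * R ^ k)"
  using weighted_coeff_summable[of R 1] by simp

lemma h_derivative:
  "((\<lambda>z. z * pseries (hahn_exton_coeff a q) z) has_field_derivative pseries (derivative_coeff a q) z)
     (at (z::'a::{real_normed_field, banach}))"
  by (intro mult_pseries_has_field_derivative coeff_summable)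

lemma zh'_derivative:
  "((\<lambda>z. z * pseries (derivative_coeff a q) z) has_field_derivative pseries (convexity_coeff a q) z)
     (at (z::'a::{real_normed_field, banach}))"
proof -
  have "convexity_coeff a q = (\<lambda>k. real (Suc k) * derivative_coeff a q k)" by (simp add: power2_eq_square fun_eq_iff)
  thus ?thesis using mult_pseries_has_field_derivative[of "derivative_coeff a q" z] derivative_coeff_summable by simp
qed

text \<open>
  With \<open>x = sqrt r\<close> and \<open>D = x * d/dx\<close>, the left-hand side is
  \<open>x powr (\<nu> - 2) * D^2 (x powr (2 - \<nu>) * J(x))\<close>. Since \<open>x powr (2 - \<nu>) * J(x)\<close> is a constant times \<open>h(x^2)\<close> and
  \<open>D\<close> acts on functions of \<open>r = x^2\<close> as \<open>2 * r * d/dr\<close>, \<open>D^2\<close> of that function is the constant times \<open>4 * r * (r h'(r))'\<close>.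
\<close>

lemma convexity_equation_eq_series:
  assumes r: "0 < r"
  shows "(2 - \<nu>) ^ 2 * hahn_exton_J \<nu> q (sqrt r)
           + (5 - 2 * \<nu>) * sqrt r * deriv (hahn_exton_J \<nu> q) (sqrt r)
           + r * deriv (deriv (hahn_exton_J \<nu> q)) (sqrt r) =
         4 * hahn_exton_const a q * sqrt r powr \<nu> * pseries (convexity_coeff a q) r"
proof -
  let ?h = "\<lambda>s::real. s * pseries (hahn_exton_coeff a q) s"
  let ?u = "\<lambda>s::real. s * pseries (derivative_coeff a q) s"
  define J1 where "J1 t = hahn_exton_const a q * 
    ((\<nu> - 2) * (t powr (\<nu> - 3) * ?h (t\<^sup>2)) + 2 * (t powr (\<nu> - 3) * ?u (t\<^sup>2)))" for t
  define J2 where "J2 t = hahn_exton_const a q *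
    ((\<nu> - 2) * ((\<nu> - 3) * t powr (\<nu> - 4) * ?h (t\<^sup>2)
        + t powr (\<nu> - 3) * (pseries (derivative_coeff a q) (t\<^sup>2) * (2 * t)))
      + 2 * ((\<nu> - 3) * t powr (\<nu> - 4) * ?u (t\<^sup>2)
        + t powr (\<nu> - 3) * (pseries (convexity_coeff a q) (t\<^sup>2) * (2 * t))))" for t
  have dsq: "((\<lambda>t. t\<^sup>2) has_real_derivative 2 * t) (at t)" for t :: real
    by (auto intro!: derivative_eq_intros)
  have dh: "((\<lambda>t. ?h (t\<^sup>2)) has_real_derivative pseries (derivative_coeff a q) (t\<^sup>2) * (2 * t)) (at t)" for t
    by (rule DERIV_chain2[OF h_derivative dsq])
  have du: "((\<lambda>t. ?u (t\<^sup>2)) has_real_derivative pseries (convexity_coeff a q) (t\<^sup>2) * (2 * t)) (at t)" for t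
    by (rule DERIV_chain2[OF zh'_derivative dsq])
  have dp: "((\<lambda>t. t powr e) has_real_derivative e * t powr (e - 1)) (at t)" if "0 < t" for e t :: real
    using that by (rule has_real_derivative_powr)
  have J: "(hahn_exton_J \<nu> q has_real_derivative J1 t) (at t)" if t: "0 < t" for t
  proof (rule has_field_derivative_transform_within_open)
    have "((\<lambda>t. hahn_exton_const a q * (t powr (\<nu> - 2) * ?h (t\<^sup>2))) has_real_derivative
        hahn_exton_const a q * ((\<nu> - 2) * t powr (\<nu> - 2 - 1) * ?h (t\<^sup>2)
          + pseries (derivative_coeff a q) (t\<^sup>2) * (2 * t) * t powr (\<nu> - 2))) (at t)"
      by (intro DERIV_cmult DERIV_mult dp t dh)
    moreover have "t powr (\<nu> - 2) = t powr (\<nu> - 3) * t" using t powr_add[of t "\<nu> - 3" 1] by simp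
    ultimately show "((\<lambda>t. hahn_exton_const a q * (t powr (\<nu> - 2) * ?h (t\<^sup>2))) has_real_derivative J1 t) (at t)"
      by (simp add: J1_def algebra_simps power2_eq_square)
    show "\<And>s. s \<in> {0<..} \<Longrightarrow> hahn_exton_const a q * (s powr (\<nu> - 2) * ?h (s\<^sup>2)) = hahn_exton_J \<nu> q s"
      by (simp add: hahn_exton_J_eq)
  qed (use t in auto)
  have dJ: "deriv (hahn_exton_J \<nu> q) t = J1 t" if "0 < t" for t
    using J[OF that] by (rule DERIV_imp_deriv)
  have "(deriv (hahn_exton_J \<nu> q) has_real_derivative J2 t) (at t)" if t: "0 < t" for t
  proof (rule has_field_derivative_transform_within_open)
    have "(J1 has_real_derivative hahn_exton_const a q *
        ((\<nu> - 2) * ((\<nu> - 3) * t powr (\<nu> - 3 - 1) * ?h (t\<^sup>2)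
            + pseries (derivative_coeff a q) (t\<^sup>2) * (2 * t) * t powr (\<nu> - 3))
         + 2 * ((\<nu> - 3) * t powr (\<nu> - 3 - 1) * ?u (t\<^sup>2)
            + pseries (convexity_coeff a q) (t\<^sup>2) * (2 * t) * t powr (\<nu> - 3)))) (at t)"
      unfolding J1_def[abs_def] by (intro DERIV_cmult DERIV_add DERIV_mult dp t dh du)
    thus "(J1 has_real_derivative J2 t) (at t)"
      by (simp add: J2_def mult_ac)
    show "\<And>s. s \<in> {0<..} \<Longrightarrow> J1 s = deriv (hahn_exton_J \<nu> q) s"
      by (simp add: dJ)
  qed (use t in auto)
  hence ddJ: "deriv (deriv (hahn_exton_J \<nu> q)) t = J2 t" if "0 < t" for t
    using that DERIV_imp_deriv by blast
  define t where "t = sqrt r"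
  have t: "0 < t" "r = t\<^sup>2" using r by (simp_all add: t_def)
  (* In terms of the lowest power of t the claim is a polynomial identity. *)
  define w where "w = t powr (\<nu> - 4)"
  have w: "t powr (\<nu> - 3) = w * t" "t powr (\<nu> - 2) = w * t^2" "t powr \<nu> = w * t^4"
    using t(1) powr_add[of t "\<nu> - 4" 1] powr_add[of t "\<nu> - 4" 2] powr_add[of t "\<nu> - 4" 4]
    by (simp_all add: w_def)
  show ?thesis
    unfolding t_def[symmetric] dJ[OF t(1)] ddJ[OF t(1)] hahn_exton_J_eq[OF t(1)] J1_def J2_def w
      w_def[symmetric]
    unfolding t(2) by algebra
qed

text \<open>
  Stated with \<open>a\<close> and natural powers of \<open>q\<close>, where the bounds are rational functions.
\<close>

lemma convexity_radius:
  "\<exists>rc::real. radius_of_convexity (hahn_exton_h \<nu> q) = ereal rc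
    \<and> smallest_positive_root
        (\<lambda>r. (2 - \<nu>) ^ 2 * hahn_exton_J \<nu> q (sqrt r)
           + (5 - 2 * \<nu>) * sqrt r * deriv (hahn_exton_J \<nu> q) (sqrt r)
           + r * deriv (deriv (hahn_exton_J \<nu> q)) (sqrt r)) rc
    \<and> (1 - q) * (1 - a) / (4 * q) < rc
    \<and> rc < 2 * (a - 1) * (a * q - 1) * (q^2 - 1) / (q * (8 * (a * q^2) - a * q + q - 8))
    \<and> sqrt ((1 - q)^2 * (1 + q) * (1 - a)^2 * (a * q - 1) / (2 * q^2 * (8 * (a * q^2) - a * q + q - 8))) < rc
    \<and> rc < (1 - a) * (1 - a * q^2) * (8 * (a * q^2) - a * q + q - 8) * ((q - 1) * (q^3 + 2 * q^2 + 2 * q + 1))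
        / (2 * q * (1 + q) * (5 * q + 11 * (a * q) - 21 * (a * q^2) - 34 * (a * q^3) - 21 * (a * q^4) + 11 * (a * q^5)
           + (a^2 * q^3 + 5 * (a^2 * q^4) + 5 * (a^2 * q^5) + 16 * (a^2 * q^6) + 5 * q^2 + q^3 + 16)))"
proof -
  note approx = hahn_exton_approximants[OF q a_bounds]
  obtain y where y: "\<forall>N. (\<forall>i<N. 0 < y N i) \<and> (\<forall>k. coeff (root_prod (y N) N :: real poly) k =
      damping a q N k * derivative_coeff a q k)"
    using choice[OF allI[OF approx(1)]] ..
  obtain x where x: "\<forall>N. (\<forall>i<N. 0 < x N i) \<and> (\<forall>k. coeff (root_prod (x N) N :: real poly) k =
      damping a q N k * convexity_coeff a q k)"
    using choice[OF allI[OF approx(2)]] ..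
  have coeff_0: "hahn_exton_coeff a q 0 = 1" by (simp add: hahn_exton_coeff_def qpoch_def)
  note common = q a_bounds coeff_0 hahn_exton_coeff_nonzero damping_bounds damping_tendsto
  interpret H: real_rooted_limit "derivative_coeff a q" "damping a q" y
    using y hahn_exton_coeff_ratio_tendsto[OF q a_bounds, of 1]
    by unfold_locales (auto simp: common)
  interpret G: real_rooted_limit "convexity_coeff a q" "damping a q" x
    using x hahn_exton_coeff_ratio_tendsto[OF q a_bounds, of 2]
    by unfold_locales (auto simp: common)
  have convexity_coeff_eq: "convexity_coeff a q = (\<lambda>k. real (Suc k) * derivative_coeff a q k)"
    by (simp add: power2_eq_square fun_eq_iff)
  have weighted_summable: "summable (\<lambda>k. \<bar>real (Suc k) * derivative_coeff a q k\<bar> * R ^ k)"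
    if "0 \<le> R" for R
    using G.g_summable[OF that] by (simp add: power2_eq_square mult.assoc)
  obtain \<gamma> :: real where \<gamma>: "0 < \<gamma>" "pseries (convexity_coeff a q) \<gamma> = 0"
    and G_pos': "\<forall>t. 0 \<le> t \<longrightarrow> t < \<gamma> \<longrightarrow> 0 < pseries (convexity_coeff a q) t"
    using G.exists_first_zero by (elim exE conjE) (rule that)
  note G_pos = G_pos'[rule_format]
  (* r h'(r) increases as long as its derivative G is positive, so h' cannot vanish before G does. *)
  have H_pos: "0 < pseries (derivative_coeff a q) t" if t: "0 \<le> t" "t < \<gamma>" for t :: real
  proof (cases "t = 0")
    case False
    have "0 * pseries (derivative_coeff a q) 0 < t * pseries (derivative_coeff a q) t"
    proof (rule DERIV_pos_imp_increasing[where f = "\<lambda>z. z * pseries (derivative_coeff a q) z"])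
      show "0 < t" using t False by simp
      show "\<exists>D. ((\<lambda>z. z * pseries (derivative_coeff a q) z) has_real_derivative D) (at s) \<and> 0 < D"
        if "0 \<le> s" "s \<le> t" for s
        using that t G_pos[of s] zh'_derivative[of s] by auto
    qed
    thus ?thesis using t False by (simp add: zero_less_mult_iff)
  qed (use H.pseries_at_0 in simp)
  have dh: "deriv (hahn_exton_h \<nu> q) = pseries (derivative_coeff a q)"
    unfolding hahn_exton_h_eq[abs_def] by (intro ext DERIV_imp_deriv h_derivative)
  have quotient: "1 + z * deriv (deriv (hahn_exton_h \<nu> q)) z / deriv (hahn_exton_h \<nu> q) z =
      pseries (convexity_coeff a q) z / deriv (hahn_exton_h \<nu> q) z" if "pseries (derivative_coeff a q) z \<noteq> 0" for z
  proof (rule convexity_quotient)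
    show "deriv (hahn_exton_h \<nu> q) field_differentiable at z"
      unfolding dh field_differentiable_def
      using pseries_has_field_derivative[of "derivative_coeff a q" z] derivative_coeff_summable by blast
  qed (use that zh'_derivative in \<open>simp_all add: dh\<close>)
  have radius: "radius_of_convexity (hahn_exton_h \<nu> q) = ereal \<gamma>"
  proof (rule radius_of_convexity_eqI)
    fix z :: complex assume z: "norm z < \<gamma>"
    have Hz: "pseries (derivative_coeff a q) (norm z) \<le> norm (pseries (derivative_coeff a q) z)"
      using z by (intro H.norm_pseries_ge H_pos) auto
    moreover have H0: "0 < pseries (derivative_coeff a q) (norm z)" using z by (intro H_pos) auto
    ultimately have nz: "pseries (derivative_coeff a q) z \<noteq> 0" by auto
    have "0 < pseries (convexity_coeff a q) (norm z) / pseries (derivative_coeff a q) (norm z)"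
      using z H0 by (intro divide_pos_pos G_pos) auto
    also have "\<dots> \<le> Re (pseries (convexity_coeff a q) z / pseries (derivative_coeff a q) z)"
      unfolding convexity_coeff_eq using z weighted_summable
      by (intro H.Re_weighted_quotient_ge H_pos) auto
    finally show "deriv (hahn_exton_h \<nu> q) z \<noteq> 0 \<and>
        0 < Re (1 + z * deriv (deriv (hahn_exton_h \<nu> q)) z / deriv (hahn_exton_h \<nu> q) z)"
      using nz unfolding quotient[OF nz] unfolding dh by simp
  next
    have "pseries (convexity_coeff a q) (of_real \<gamma> :: complex) = 0"
      using pseries_of_real[OF G.g_summable, of \<gamma>] \<gamma>(2) by simp
    thus "deriv (hahn_exton_h \<nu> q) (of_real \<gamma>) \<noteq> 0 \<longrightarrow> 1 + of_real \<gamma> *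
        deriv (deriv (hahn_exton_h \<nu> q)) (of_real \<gamma>) / deriv (hahn_exton_h \<nu> q) (of_real \<gamma>) = 0"
      using quotient[of "of_real \<gamma>"] by (simp add: dh)
  qed (use \<gamma> in auto)
  have root: "smallest_positive_root
        (\<lambda>r. (2 - \<nu>) ^ 2 * hahn_exton_J \<nu> q (sqrt r)
           + (5 - 2 * \<nu>) * sqrt r * deriv (hahn_exton_J \<nu> q) (sqrt r)
           + r * deriv (deriv (hahn_exton_J \<nu> q)) (sqrt r)) \<gamma>"
    unfolding smallest_positive_root_def
  proof (intro conjI allI impI)
    show "(2 - \<nu>) ^ 2 * hahn_exton_J \<nu> q (sqrt \<gamma>)
           + (5 - 2 * \<nu>) * sqrt \<gamma> * deriv (hahn_exton_J \<nu> q) (sqrt \<gamma>)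
           + \<gamma> * deriv (deriv (hahn_exton_J \<nu> q)) (sqrt \<gamma>) = 0"
      unfolding convexity_equation_eq_series[OF \<gamma>(1)] \<gamma>(2) by simp
  next
    fix s assume s: "0 < s \<and> (2 - \<nu>) ^ 2 * hahn_exton_J \<nu> q (sqrt s)
           + (5 - 2 * \<nu>) * sqrt s * deriv (hahn_exton_J \<nu> q) (sqrt s)
           + s * deriv (deriv (hahn_exton_J \<nu> q)) (sqrt s) = 0"
    hence "4 * hahn_exton_const a q * sqrt s powr \<nu> * pseries (convexity_coeff a q) s = 0"
      using convexity_equation_eq_series[of s] by simp
    hence "pseries (convexity_coeff a q) s = 0" using s const_nonzero by simp
    thus "\<gamma> \<le> s" using G_pos[of s] s by force
  qed (rule \<gamma>(1))
  have weights: "convexity_coeff a q 1 = 4 * hahn_exton_coeff a q 1" "convexity_coeff a q 2 = 9 * hahn_exton_coeff a q 2"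
      "convexity_coeff a q 3 = 16 * hahn_exton_coeff a q 3"
    by simp_all
  note sums = G.power_sums_first_zero[OF \<gamma> G_pos]
  note P_eq = G.power_sums_eq[unfolded weights]
  have "0 < (1 / \<gamma>) ^ 2" using \<gamma>(1) by simp
  hence P1: "0 < G.power_sum 1" using sums(2) by linarith
  have "0 < (1 / \<gamma>) ^ Suc 2" using \<gamma>(1) by simp
  hence P2: "0 < G.power_sum 2" using G.power_sum_ge_of_zero[OF \<gamma>, of 2] by linarith
  have "0 < 1 / \<gamma>" using \<gamma>(1) by simp
  hence P0: "0 < G.power_sum 0" using sums(1) by linarith
  note bounds = bounds_in_terms_of_power_sums[OF q a_bounds, folded P_eq, OF P1 P2]
  have "1 / G.power_sum 0 < \<gamma>" using sums(1) P0 \<gamma>(1) by (simp add: field_simps)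
  moreover have "\<gamma> < G.power_sum 0 / G.power_sum 1" using sums(3) P1 by (simp add: field_simps)
  moreover have "sqrt (1 / G.power_sum 1) < \<gamma>"
  proof (rule real_less_lsqrt)
    show "1 / G.power_sum 1 < \<gamma>\<^sup>2" using sums(2) P1 \<gamma>(1) by (simp add: field_simps)
  qed (use \<gamma>(1) P1 in auto)
  moreover have "\<gamma> < G.power_sum 1 / G.power_sum 2" using sums(4) P2 by (simp add: field_simps)
  ultimately show ?thesis
    unfolding bounds using radius root by blast
qed

end

theorem theorem4:
  fixes \<nu> q :: real
  assumes "\<nu> > -1" and "0 < q" and "q < 1"
  shows "\<exists>rc::real. radius_of_convexity (hahn_exton_h \<nu> q) = ereal rc
    \<and> smallest_positive_root
        (\<lambda>r. (2 - \<nu>) ^ 2 * hahn_exton_J \<nu> q (sqrt r)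
           + (5 - 2 * \<nu>) * sqrt r * deriv (hahn_exton_J \<nu> q) (sqrt r)
           + r * deriv (deriv (hahn_exton_J \<nu> q)) (sqrt r)) rc
    \<and> (1 - q) * (1 - q powr (\<nu> + 1)) / (4 * q) < rc
    \<and> rc < 2 * (q powr (\<nu> + 1) - 1) * (q powr (\<nu> + 2) - 1) * (q ^ 2 - 1) / (q * E_poly \<nu> q)
    \<and> sqrt ((1 - q) ^ 2 * (1 + q) * (1 - q powr (\<nu> + 1)) ^ 2 * (q powr (\<nu> + 2) - 1)
            / (2 * q ^ 2 * E_poly \<nu> q)) < rc
    \<and> rc < (1 - q powr (\<nu> + 1)) * (1 - q powr (\<nu> + 3)) * E_poly \<nu> q * T_poly q
            / (2 * q * (1 + q) * (K_poly \<nu> q + L_poly \<nu> q))"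
proof -
  have p: "q powr (\<nu> + 2) = q powr (\<nu> + 1) * q"
    "q powr (\<nu> + 3) = q powr (\<nu> + 1) * q^2" "q powr (\<nu> + 4) = q powr (\<nu> + 1) * q^3"
    "q powr (\<nu> + 5) = q powr (\<nu> + 1) * q^4" "q powr (\<nu> + 6) = q powr (\<nu> + 1) * q^5"
    using powr_add[of q "\<nu> + 1" 1] powr_add[of q "\<nu> + 1" 2] powr_add[of q "\<nu> + 1" 3]
      powr_add[of q "\<nu> + 1" 4] powr_add[of q "\<nu> + 1" 5] assms(2) by (simp_all add: add.commute)
  have p2: "q powr (2 * \<nu> + 2) = (q powr (\<nu> + 1))\<^sup>2"
    by (simp add: power2_eq_square powr_add[symmetric])
  have p': "q powr (2 * \<nu> + 5) = (q powr (\<nu> + 1))\<^sup>2 * q^3" "q powr (2 * \<nu> + 6) = (q powr (\<nu> + 1))\<^sup>2 * q^4"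
    "q powr (2 * \<nu> + 7) = (q powr (\<nu> + 1))\<^sup>2 * q^5" "q powr (2 * \<nu> + 8) = (q powr (\<nu> + 1))\<^sup>2 * q^6"
    using powr_add[of q "2 * \<nu> + 2" 3] powr_add[of q "2 * \<nu> + 2" 4]
      powr_add[of q "2 * \<nu> + 2" 5] powr_add[of q "2 * \<nu> + 2" 6] assms(2)
    unfolding p2 by (simp_all add: add.commute)
  show ?thesis
    unfolding E_poly_def K_poly_def L_poly_def T_poly_def p p'
    using convexity_radius[OF assms refl] .
qed

end
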